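(* Let $E=\mathrm{KZ}_8\subset\mathbb{R}^8$ be an even unimodular lattice of rank $8$ (the $E_8$ lattice, unique up to isometry), and for $m>0$ let $E_m=\{x\in E\mid\langle x,x\rangle=m\}$. Then: (i) $X=\frac{1}{\sqrt2}E_2\cup\frac12E_4\subset S^7$ is the support of a cubature formula of strength $11$ on $S^7$ (i.e. there is $W:X\to\mathbb{R}_{>0}$ with $(X,W)$ a cubature formula of strength $11$), of size $2400$. (ii) $X=\frac{1}{\sqrt2}E_2\cup\frac{1}{\sqrt6}E_6\cup\frac{1}{2\sqrt2}E_8\subset S^7$ is the support of a cubature formula of strength $13$ on $S^7$, of size $24240$. (iii) $X=\frac{1}{\sqrt2}E_2\cup\frac12E_4\cup\frac{1}{\sqrt6}E_6\cup\frac{1}{2\sqrt2}E_8\subset S^7$ is the support of a cubature formula of strength $15$ on $S^7$, of size $26400$.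
   Context: A lattice $\Lambda\subset\mathbb{R}^n$ is even if $\langle x,x\rangle\in2\mathbb{Z}$ for all $x\in\Lambda$, and unimodular if it equals its dual $\{y\mid\langle y,\Lambda\rangle\subset\mathbb{Z}\}$. For $r>0$, $S^{n-1}_r=\{x\in\mathbb{R}^n\mid\langle x,x\rangle=r\}$, $S^{n-1}=S^{n-1}_1$, and $\sigma$ is the rotation-invariant probability measure on it. A cubature formula of strength $t$ on $S^{n-1}$ is a pair $(X,W)$ with $X\subset S^{n-1}$ finite and $W:X\to\mathbb{R}_{>0}$ such that $\sum_{x\in X}W(x)f(x)=\int_{S^{n-1}}f\,d\sigma$ for every polynomial $f:\mathbb{R}^n\to\mathbb{C}$ of degree at most $t$; its size is $|X|$ (the number of distinct points). *)

theory Defs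
  imports "HOL-Probability.Probability"
begin

definition is_lattice :: "(real ^ 'n) set \<Rightarrow> bool" where
  "is_lattice L \<longleftrightarrow>
     (\<exists>B. independent B \<and> span B = UNIV \<and>
          L = {\<Sum>b\<in>B. of_int (c b) *\<^sub>R b | c :: real ^ 'n \<Rightarrow> int. True})"

definition dual_lattice :: "(real ^ 'n) set \<Rightarrow> (real ^ 'n) set" where
  "dual_lattice L = {y. \<forall>x\<in>L. y \<bullet> x \<in> \<int>}"

definition even_lattice :: "(real ^ 'n) set \<Rightarrow> bool" where
  "even_lattice L \<longleftrightarrow> is_lattice L \<and> (\<forall>x\<in>L. \<exists>k::int. x \<bullet> x = 2 * of_int k)"

definition unimodular_lattice :: "(real ^ 'n) set \<Rightarrow> bool" where
  "unimodular_lattice L \<longleftrightarrow> is_lattice L \<and> L = dual_lattice L"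

definition shell :: "(real ^ 'n) set \<Rightarrow> real \<Rightarrow> (real ^ 'n) set" where
  "shell L m = {x\<in>L. x \<bullet> x = m}"

text \<open>The sum ranges over the finitely many monomials of total degree at most \<open>t\<close>.\<close>

definition poly_fun_deg_le :: "nat \<Rightarrow> (real ^ 'n \<Rightarrow> complex) \<Rightarrow> bool" where
  "poly_fun_deg_le t f \<longleftrightarrow>
     (\<exists>c :: ('n \<Rightarrow> nat) \<Rightarrow> complex.
        f = (\<lambda>x. \<Sum>a | (\<Sum>i\<in>UNIV. a i) \<le> t.
                    c a * (\<Prod>i\<in>UNIV. complex_of_real (x $ i) ^ a i)))"

lemma finite_multi_indices: "finite {a :: 'n::finite \<Rightarrow> nat. (\<Sum>i\<in>UNIV. a i) \<le> t}"
proof (rule finite_subset)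
  show "{a :: 'n \<Rightarrow> nat. (\<Sum>i\<in>UNIV. a i) \<le> t} \<subseteq> PiE UNIV (\<lambda>_. {..t})"
  proof
    fix a :: "'n \<Rightarrow> nat" assume "a \<in> {a. (\<Sum>i\<in>UNIV. a i) \<le> t}"
    moreover have "a j \<le> (\<Sum>i\<in>UNIV. a i)" for j by (rule member_le_sum) auto
    ultimately show "a \<in> PiE UNIV (\<lambda>_. {..t})" by (fastforce intro: order_trans)
  qed
qed (rule finite_PiE; simp)

text \<open>
  A Borel probability measure on the unit sphere that is invariant under rotations.
  Since \<open>SO(n)\<close> acts transitively on the sphere for \<open>n \<ge> 2\<close>, there is exactly one such measure
  in these dimensions. Existence is shown below.
\<close>

definition rotation_invariant_prob :: "(real ^ 'n) measure \<Rightarrow> bool" where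
  "rotation_invariant_prob \<sigma> \<longleftrightarrow>
     prob_space \<sigma> \<and>
     space \<sigma> = sphere 0 1 \<and>
     sets \<sigma> = sets (restrict_space borel (sphere 0 1)) \<and>
     (\<forall>A :: real ^ 'n ^ 'n. rotation_matrix A \<longrightarrow> distr \<sigma> \<sigma> (\<lambda>x. A *v x) = \<sigma>)"

definition cubature_formula ::
  "(real ^ 'n) measure \<Rightarrow> nat \<Rightarrow> (real ^ 'n) set \<Rightarrow> (real ^ 'n \<Rightarrow> real) \<Rightarrow> bool" where
  "cubature_formula \<sigma> t X W \<longleftrightarrow>
     finite X \<and> X \<subseteq> sphere 0 1 \<and> (\<forall>x\<in>X. W x > 0) \<and>
     (\<forall>f. poly_fun_deg_le t f \<longrightarrow>
        (\<Sum>x\<in>X. complex_of_real (W x) * f x) = (\<integral>x. f x \<partial>\<sigma>))"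

text \<open>The radial projection of normalised Lebesgue measure on the ball is rotation invariant.\<close>

lemma emeasure_lborel_vimage_orthogonal:
  fixes T :: "real ^ 'n::{finite,wellorder} \<Rightarrow> real ^ 'n::_"
  assumes T: "orthogonal_transformation T" and B: "B \<in> sets borel" "bounded B"
  shows "emeasure lborel (T -` B) = emeasure lborel B"
proof -
  have bij: "bij T" using T by (rule orthogonal_transformation_bij)
  have inv: "orthogonal_transformation (inv T)" using T by (rule orthogonal_transformation_inv)
  have im: "T -` B = inv T ` B" using bij by (rule bij_vimage_eq_inv_image)
  have "continuous_on UNIV T"
    using T by (intro linear_continuous_on linear_conv_bounded_linear[THEN iffD1]
        orthogonal_transformation_linear)
  then have T_borel: "T \<in> borel_measurable borel" by (rule borel_measurable_continuous_onI)
  have mB: "B \<in> lmeasurable"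
    using B by (intro bounded_set_imp_lmeasurable) (auto intro: sets_completionI_sets)
  have sets: "T -` B \<in> sets borel" using measurable_sets[OF T_borel B(1)] by simp
  have mTB: "T -` B \<in> lmeasurable"
    unfolding im by (rule measurable_orthogonal_image[OF inv mB])
  have "measure lebesgue (T -` B) = measure lebesgue B"
    unfolding im by (rule measure_orthogonal_image[OF inv mB])
  then have "emeasure lebesgue (T -` B) = emeasure lebesgue B"
    by (simp only: emeasure_eq_ennreal_measure[OF fmeasurableD2[OF mB]]
        emeasure_eq_ennreal_measure[OF fmeasurableD2[OF mTB]])
  then show ?thesis using B sets by (simp add: emeasure_completion)
qed

lemma rotation_invariant_prob_exists:
  "\<exists>\<sigma> :: (real ^ 'n::{finite,wellorder}) measure. rotation_invariant_prob \<sigma>"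
proof -
  define S where "S = restrict_space borel (sphere (0::real ^ 'n::_) 1)"
  define D where "D = ball (0::real ^ 'n::_) 1 - {0}"
  define M where "M = restrict_space (uniform_measure lborel D) D"
  define p where "p = (\<lambda>x::real ^ 'n::_. x /\<^sub>R norm x)"
  define \<sigma> where "\<sigma> = distr M S p"
  have space_S: "space S = sphere 0 1" by (simp add: S_def space_restrict_space)
  have space_M: "space M = D" by (simp add: M_def space_restrict_space)
  have D_borel: "D \<in> sets borel" by (simp add: D_def)
  have D_open: "open D" unfolding D_def by (intro open_Diff) auto
  have D_bounded: "bounded D" by (auto simp: D_def intro: bounded_subset[of "ball 0 1"])
  have "(1/2) *\<^sub>R axis undefined 1 \<in> D" by (auto simp: D_def axis_eq_0_iff)
  then have D_ne: "D \<noteq> {}" by auto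
  have fin: "emeasure lborel D < \<infinity>"
    by (rule emeasure_bounded_finite[OF D_bounded])
  have pos: "emeasure lborel D \<noteq> 0"
  proof
    assume "emeasure lborel D = 0"
    then have "negligible D"
      using D_borel by (simp add: negligible_iff_null_sets null_sets_def emeasure_completion)
    then show False using open_not_negligible[OF D_open D_ne] by simp
  qed
  have one: "emeasure (uniform_measure lborel D) D = 1"
    using D_borel pos fin by (intro emeasure_uniform_measure_1) auto
  have probM: "prob_space M"
    unfolding M_def by (rule prob_space_restrict_space) (use D_borel one in auto)
  have p_borel: "p \<in> borel_measurable borel" unfolding p_def by measurable
  have meas_p: "p \<in> measurable M S"
    unfolding S_def
  proof (rule measurable_restrict_space2)
    show "p \<in> space M \<rightarrow> sphere 0 1" by (auto simp: space_M p_def D_def)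
    show "p \<in> borel_measurable M"
      unfolding M_def using p_borel by (intro measurable_restrict_space1) simp
  qed
  have emb: "A \<in> sets borel" if "A \<in> sets S" for A
    using that by (auto simp: S_def sets_restrict_space)
  have em: "emeasure \<sigma> A = emeasure lborel (p -` A \<inter> D) / emeasure lborel D"
    and pA: "p -` A \<inter> D \<in> sets borel" if A: "A \<in> sets S" for A
  proof -
    show *: "p -` A \<inter> D \<in> sets borel"
      using measurable_sets[OF p_borel emb[OF A]] D_borel by auto
    have "emeasure \<sigma> A = emeasure M (p -` A \<inter> D)"
      unfolding \<sigma>_def using emeasure_distr[OF meas_p A] by (simp add: space_M)
    also have "\<dots> = emeasure (uniform_measure lborel D) (p -` A \<inter> D)"
      unfolding M_def by (rule emeasure_restrict_space) (use D_borel in auto)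
    also have "\<dots> = emeasure lborel (p -` A \<inter> D) / emeasure lborel D"
      using * D_borel by (simp add: Int_absorb1)
    finally show "emeasure \<sigma> A = emeasure lborel (p -` A \<inter> D) / emeasure lborel D" .
  qed
  have inv: "distr \<sigma> \<sigma> (\<lambda>x. Q *v x) = \<sigma>" if Q: "rotation_matrix Q" for Q :: "real ^ 'n::_ ^ 'n::_"
  proof (rule measure_eqI)
    let ?T = "\<lambda>x. Q *v x"
    have T: "orthogonal_transformation ?T"
      using Q by (simp add: rotation_matrix_def orthogonal_transformation_matrix)
    have nT: "norm (?T x) = norm x" for x
      using T by (rule orthogonal_transformation_norm)
    have "continuous_on UNIV ?T"
      by (intro linear_continuous_on linear_conv_bounded_linear[THEN iffD1]
        orthogonal_transformation_linear T)
    then have "?T \<in> borel_measurable borel" by (rule borel_measurable_continuous_onI)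
    then have meas_T: "?T \<in> measurable S S"
      unfolding S_def by (intro measurable_restrict_space3) (auto simp: nT)
    then have meas_T': "?T \<in> measurable \<sigma> \<sigma>" by (simp add: \<sigma>_def)
    show "sets (distr \<sigma> \<sigma> ?T) = sets \<sigma>" by simp
    fix A assume "A \<in> sets (distr \<sigma> \<sigma> ?T)"
    then have A: "A \<in> sets S" "A \<in> sets \<sigma>" by (auto simp: \<sigma>_def)
    have TA: "?T -` A \<inter> sphere 0 1 \<in> sets S"
      using measurable_sets[OF meas_T A(1)] by (simp add: space_S)
    have pT: "p (?T x) = ?T (p x)" for x
      by (simp add: p_def nT matrix_vector_mult_scaleR)
    have eq: "p -` (?T -` A \<inter> sphere 0 1) \<inter> D = ?T -` (p -` A \<inter> D)"
    proof (rule set_eqI)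
      fix x
      have "?T x = 0 \<longleftrightarrow> x = 0" using nT[of x] by (metis norm_eq_zero)
      then have "?T x \<in> D \<longleftrightarrow> x \<in> D" by (simp add: D_def nT)
      moreover have "x \<in> D \<Longrightarrow> norm (p x) = 1" by (auto simp: D_def p_def)
      ultimately show "x \<in> p -` (?T -` A \<inter> sphere 0 1) \<inter> D \<longleftrightarrow> x \<in> ?T -` (p -` A \<inter> D)"
        by (auto simp: pT)
    qed
    have "emeasure (distr \<sigma> \<sigma> ?T) A = emeasure \<sigma> (?T -` A \<inter> sphere 0 1)"
      using emeasure_distr[OF meas_T' A(2)] by (simp add: \<sigma>_def space_S)
    also have "\<dots> = emeasure lborel (?T -` (p -` A \<inter> D)) / emeasure lborel D"
      by (simp only: em[OF TA] eq)
    also have "emeasure lborel (?T -` (p -` A \<inter> D)) = emeasure lborel (p -` A \<inter> D)"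
      by (rule emeasure_lborel_vimage_orthogonal[OF T pA[OF A(1)]])
         (rule bounded_subset[OF D_bounded], auto)
    also have "emeasure lborel (p -` A \<inter> D) / emeasure lborel D = emeasure \<sigma> A"
      by (simp add: em[OF A(1)])
    finally show "emeasure (distr \<sigma> \<sigma> ?T) A = emeasure \<sigma> A" .
  qed
  have "prob_space \<sigma>" unfolding \<sigma>_def by (rule prob_space.prob_space_distr[OF probM meas_p])
  moreover have "sets \<sigma> = sets (restrict_space borel (sphere 0 1))"
    by (simp add: \<sigma>_def S_def)
  moreover have "space \<sigma> = sphere 0 1" by (simp add: \<sigma>_def space_S)
  ultimately show ?thesis using inv unfolding rotation_invariant_prob_def by blast
qed

end

(*
  In rank 8, Hermite's bound forces an even unimodular lattice E to contain two orthogonal roots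
  v, w. With f = (v + w) / 2 and g = (v - w) / 2, the orthogonal complement of f, g in the
  neighbour of E along f is unimodular of rank 6, and the same bound, applied to the lattice and to
  its projections along a root and along a hexagonal sublattice, shows that it is Z^6. Hence E
  consists of the integer vectors of even coordinate sum and their translate by (1/2, ..., 1/2).

  In these coordinates the moments of a shell are coefficients of products of one-variable
  generating functions, so they depend only on the multiset of exponents. A finite check over the
  partitions of t then gives positive weights for which the weighted sum of (x . y)^t is a multiple of
  |y|^t. The sphere satisfies the same identity by rotation invariance, and polarization extends
  the agreement to all polynomials of degree t; lower even degrees follow from |x| = 1 and odd degrees
  from antipodality.
*)

theory Submission
  imports Defs "HOL-Computational_Algebra.Formal_Laurent_Series"
begin

section \<open>Short vectors in self-dual lattices\<close>

text \<open>The shape of the first half is dictated by numbers. Self-duality turns a short dual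
  vector into a lattice vector, so in rank r + 1 the minimum \<nu> satisfies \<nu>^2 <= (4/3)^r.
  Excluding a minimum of 2 needs (4/3)^r < 4, which holds up to rank 5 and just fails in rank 6,
  where (4/3)^5 = 4.21...; the two projections close this gap. E itself has no vector of norm one,
  but its neighbour contains f and g by construction, so that only rank 6 is left to the bound.
  Orthogonal roots are within reach because evenness asks only for (4/3)^7 / 2 < 4.

  The numbers of shells reflect the Weyl group of E8. Its basic invariants have degrees 2, 8, 12,
  14, 18, ..., so the invariant harmonic polynomials of positive degree below 16 form one line in
  each of the degrees 8, 12 and 14. Strengths 11, 13 and 15 thus impose one, two and three linear
  conditions on the weights of two, three and four shells. The proof verifies the resulting moment
  identities directly.\<close>

definition add_subgroup :: "'a::ab_group_add set \<Rightarrow> bool" where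
  "add_subgroup S \<longleftrightarrow> 0 \<in> S \<and> (\<forall>x\<in>S. \<forall>y\<in>S. x - y \<in> S)"

lemma add_subgroup_uminus: "add_subgroup S \<Longrightarrow> x \<in> S \<Longrightarrow> - x \<in> S"
  unfolding add_subgroup_def by (metis diff_0)

lemma add_subgroup_diff: "add_subgroup S \<Longrightarrow> x \<in> S \<Longrightarrow> y \<in> S \<Longrightarrow> x - y \<in> S"
  unfolding add_subgroup_def by blast

lemma add_subgroup_add: "add_subgroup S \<Longrightarrow> x \<in> S \<Longrightarrow> y \<in> S \<Longrightarrow> x + y \<in> S"
  using add_subgroup_uminus[of S y] add_subgroup_diff[of S x "- y"] by simp

lemma add_subgroup_scaleR_Ints:
  fixes S :: "'a::real_vector set"
  assumes "add_subgroup S" "x \<in> S" "k \<in> \<int>"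
  shows "k *\<^sub>R x \<in> S"
proof -
  have nat: "real n *\<^sub>R x \<in> S" for n
    using assms(1,2)
    by (induction n) (auto simp: add_subgroup_def algebra_simps
        intro: add_subgroup_add[OF assms(1)])
  obtain i :: int where i: "k = of_int i" using assms(3) by (auto elim: Ints_cases)
  show ?thesis
  proof (cases "0 \<le> i")
    case True
    then show ?thesis using nat[of "nat i"] by (simp add: i)
  next
    case False
    then show ?thesis using add_subgroup_uminus[OF assms(1) nat[of "nat (- i)"]] by (simp add: i)
  qed
qed

text \<open>Distinct elements differ by a nonzero element of the group, so they are at distance at
  least sqrt \<mu>. Hence \<open>S - {0}\<close> is closed and meets a ball in a compact set. This
  lets the reduction run on subgroups without choosing a basis.\<close>

lemma add_subgroup_shortest_vector:
  fixes S :: "'a::euclidean_space set"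
  assumes S: "add_subgroup S" and \<mu>: "\<mu> > 0" "\<And>x. x \<in> S \<Longrightarrow> x \<noteq> 0 \<Longrightarrow> \<mu> \<le> x \<bullet> x"
    and x0: "x0 \<in> S" "x0 \<noteq> 0"
  obtains b where "b \<in> S" "b \<noteq> 0" "\<And>x. x \<in> S \<Longrightarrow> x \<noteq> 0 \<Longrightarrow> b \<bullet> b \<le> x \<bullet> x"
proof -
  define K where "K = (S - {0}) \<inter> cball 0 (norm x0)"
  have "closed (S - {0})"
  proof (rule discrete_imp_closed)
    show "0 < sqrt \<mu>" using \<mu> by simp
    show "\<forall>x\<in>S - {0}. \<forall>y\<in>S - {0}. dist y x < sqrt \<mu> \<longrightarrow> y = x"
    proof (intro ballI impI)
      fix x y assume xy: "x \<in> S - {0}" "y \<in> S - {0}" "dist y x < sqrt \<mu>"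
      have "y - x \<in> S" using xy S by (auto simp: add_subgroup_def)
      moreover have "(y - x) \<bullet> (y - x) < \<mu>"
        using xy(3) by (metis dist_norm norm_lt_square norm_eq_sqrt_inner real_sqrt_less_iff)
      ultimately show "y = x" using \<mu>(2)[of "y - x"] by fastforce
    qed
  qed
  then have "compact K" unfolding K_def by (intro closed_Int_compact) auto
  moreover have "x0 \<in> K" using x0 by (simp add: K_def)
  ultimately obtain b where b: "b \<in> K" "\<forall>x\<in>K. norm b \<le> norm x"
    using continuous_attains_inf[of K norm] by (force intro: continuous_intros)
  have "norm b \<le> norm x" if "x \<in> S" "x \<noteq> 0" for x
    using b(2) that bspec[OF b(2) \<open>x0 \<in> K\<close>]
    by (cases "norm x \<le> norm x0") (auto simp: K_def)
  then show thesis using that[of b] b(1) by (auto simp: K_def norm_eq_sqrt_inner)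
qed


text \<open>Every projected vector lifts to an x' whose coefficient along the shortest vector b is
  at most 1/2 in absolute value. If x' is nonzero it is at least as long as b, so the projection has
  norm at least (1 - 1/4)(b . b). The last conclusion identifies the kernel of the projection with
  the integer multiples of b.\<close>

lemma subgroup_projection:
  fixes S :: "'a::euclidean_space set"
  assumes S: "add_subgroup S" and dim: "dim S = Suc r" and "\<mu> > 0"
    and min: "\<And>x. x \<in> S \<Longrightarrow> x \<noteq> 0 \<Longrightarrow> \<mu> \<le> x \<bullet> x"
  obtains b T where "b \<in> S" "b \<noteq> 0" "add_subgroup T" "dim T = r" "T \<subseteq> span S"
    "\<And>x. x \<in> S \<Longrightarrow> x - ((x \<bullet> b) / (b \<bullet> b)) *\<^sub>R b \<in> T"
    "\<And>y. y \<in> T \<Longrightarrow> y \<bullet> b = 0" "\<And>y. y \<in> T \<Longrightarrow> y \<noteq> 0 \<Longrightarrow> 3 / 4 * \<mu> \<le> y \<bullet> y"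
    "\<And>x. x \<in> S \<Longrightarrow> x - ((x \<bullet> b) / (b \<bullet> b)) *\<^sub>R b = 0 \<Longrightarrow> (x \<bullet> b) / (b \<bullet> b) \<in> \<int>"
proof -
  have "\<not> S \<subseteq> {0}" using dim by (metis dim_eq_0 nat.distinct(1))
  then obtain x0 where "x0 \<in> S" "x0 \<noteq> 0" by auto
  then obtain b where b: "b \<in> S" "b \<noteq> 0" and short: "\<And>x. x \<in> S \<Longrightarrow> x \<noteq> 0 \<Longrightarrow> b \<bullet> b \<le> x \<bullet> x"
    using add_subgroup_shortest_vector[OF S \<open>\<mu> > 0\<close> min] by metis
  define c where "c = (\<lambda>x. (x \<bullet> b) / (b \<bullet> b))"
  define \<pi> where "\<pi> = (\<lambda>x. x - c x *\<^sub>R b)"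
  have bb: "b \<bullet> b > 0" using b by simp
  have c_diff: "c (x - y) = c x - c y" for x y by (simp add: c_def inner_diff_left diff_divide_distrib)
  have c_scale: "c (k *\<^sub>R b) = k" for k using bb by (simp add: c_def)
  have \<pi>_orth: "\<pi> x \<bullet> b = 0" for x using bb by (simp add: \<pi>_def c_def inner_diff_left)
  have pyth: "x \<bullet> x = \<pi> x \<bullet> \<pi> x + (c x)\<^sup>2 * (b \<bullet> b)" for x
  proof -
    have "x \<bullet> x = (\<pi> x + c x *\<^sub>R b) \<bullet> (\<pi> x + c x *\<^sub>R b)" by (simp add: \<pi>_def)
    moreover have "b \<bullet> \<pi> x = 0" using \<pi>_orth[of x] by (simp add: inner_commute)
    ultimately show ?thesis using \<pi>_orth[of x]
      by (simp add: inner_add_left inner_add_right power2_eq_square)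
  qed
  \<comment> \<open>Subtracting the nearest integer multiple of b leaves the projection
    unchanged.\<close>
  have reduce: "\<exists>x'\<in>S. \<pi> x' = \<pi> x \<and> \<bar>c x'\<bar> \<le> 1/2 \<and> c x - c x' \<in> \<int>" if "x \<in> S" for x
  proof (intro bexI conjI)
    let ?x = "x - of_int (round (c x)) *\<^sub>R b"
    show "?x \<in> S"
      using that b S by (intro add_subgroup_diff add_subgroup_scaleR_Ints) auto
    have c: "c ?x = c x - of_int (round (c x))" by (simp only: c_diff c_scale)
    then show "\<pi> ?x = \<pi> x" by (simp add: \<pi>_def scaleR_diff_left)
    show "\<bar>c ?x\<bar> \<le> 1/2" using of_int_round_abs_le[of "c x"] unfolding c by linarith
    show "c x - c ?x \<in> \<int>" unfolding c by simp
  qed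
  show thesis
  proof (rule that[of b "\<pi> ` S"])
    show "add_subgroup (\<pi> ` S)" unfolding add_subgroup_def
    proof (intro conjI ballI)
      show "0 \<in> \<pi> ` S" using S by (auto simp: add_subgroup_def \<pi>_def c_def image_iff intro!: bexI[of _ 0])
      fix u v assume "u \<in> \<pi> ` S" "v \<in> \<pi> ` S"
      then obtain x y where "x \<in> S" "y \<in> S" "u = \<pi> x" "v = \<pi> y" by auto
      moreover then have "u - v = \<pi> (x - y)" by (simp add: \<pi>_def c_diff algebra_simps)
      ultimately show "u - v \<in> \<pi> ` S" using add_subgroup_diff[OF S] by blast
    qed
    show sub: "\<pi> ` S \<subseteq> span S"
      using b by (auto simp: \<pi>_def intro!: span_diff span_scale intro: span_base)
    have "b \<notin> span (\<pi> ` S)"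
    proof
      assume "b \<in> span (\<pi> ` S)"
      then have "orthogonal b b"
        by (rule orthogonal_to_span) (use \<pi>_orth in \<open>auto simp: orthogonal_def inner_commute\<close>)
      then show False using b by (simp add: orthogonal_self)
    qed
    moreover have "span (insert b (\<pi> ` S)) = span S"
    proof (rule span_eq[THEN iffD2], intro conjI subsetI)
      fix x assume "x \<in> insert b (\<pi> ` S)"
      then show "x \<in> span S" using b sub by (auto intro: span_base)
    next
      fix x assume "x \<in> S"
      then have "\<pi> x + c x *\<^sub>R b \<in> span (insert b (\<pi> ` S))"
        by (intro span_add span_scale) (auto intro: span_base)
      then show "x \<in> span (insert b (\<pi> ` S))" by (simp add: \<pi>_def)
    qed
    then have "dim (insert b (\<pi> ` S)) = Suc r" using dim by (metis dim_span)
    ultimately show "dim (\<pi> ` S) = r" by (simp add: dim_insert)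
    show "3 / 4 * \<mu> \<le> y \<bullet> y" if y: "y \<in> \<pi> ` S" "y \<noteq> 0" for y
    proof -
      obtain x where x: "x \<in> S" "y = \<pi> x" using y by auto
      obtain x' where x': "x' \<in> S" "\<pi> x' = y" "\<bar>c x'\<bar> \<le> 1/2" using reduce[OF x(1)] x(2) by auto
      have "x' \<noteq> 0" using x'(2) y(2) by (auto simp: \<pi>_def c_def)
      then have "b \<bullet> b \<le> y \<bullet> y + (c x')\<^sup>2 * (b \<bullet> b)" using short[OF x'(1)] pyth[of x'] x'(2) by simp
      moreover have "(c x')\<^sup>2 \<le> (1/2)\<^sup>2" using x'(3) by (metis abs_ge_zero power2_abs power_mono)
      then have "(c x')\<^sup>2 * (b \<bullet> b) \<le> 1/4 * (b \<bullet> b)"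
        using bb by (intro mult_right_mono) (auto simp: power2_eq_square)
      moreover have "\<mu> \<le> b \<bullet> b" using min b by blast
      ultimately show ?thesis by linarith
    qed
    show "(x \<bullet> b) / (b \<bullet> b) \<in> \<int>" if x: "x \<in> S" "x - ((x \<bullet> b) / (b \<bullet> b)) *\<^sub>R b = 0" for x
    proof -
      obtain x' where x': "x' \<in> S" "\<pi> x' = \<pi> x" "\<bar>c x'\<bar> \<le> 1/2" "c x - c x' \<in> \<int>"
        using reduce[OF x(1)] by auto
      have "\<pi> x' = 0" using x' x(2) by (simp add: \<pi>_def c_def)
      then have "x' \<bullet> x' = (c x')\<^sup>2 * (b \<bullet> b)" using pyth[of x'] by simp
      also have "(c x')\<^sup>2 \<le> (1/2)\<^sup>2" using x'(3) by (metis abs_ge_zero power2_abs power_mono)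
      then have "(c x')\<^sup>2 * (b \<bullet> b) \<le> 1/4 * (b \<bullet> b)"
        using bb by (intro mult_right_mono) (auto simp: power2_eq_square)
      finally have "x' = 0" using short[OF x'(1)] bb by fastforce
      then show ?thesis using x'(4) by (simp add: c_def)
    qed
  qed (use b \<pi>_orth in \<open>auto simp: \<pi>_def c_def\<close>)
qed

text \<open>Hermite's constant argument: the shortest vector is split off, which costs a factor \<open>3/4\<close>
  in the minimum of the projected group, and a dual vector of the projection is dual to \<open>S\<close> as well.\<close>

lemma exists_short_dual_vector:
  fixes S :: "'a::euclidean_space set"
  assumes "add_subgroup S" "dim S = Suc r" "\<mu> > 0" "\<And>x. x \<in> S \<Longrightarrow> x \<noteq> 0 \<Longrightarrow> \<mu> \<le> x \<bullet> x"
  shows "\<exists>p\<in>span S. p \<noteq> 0 \<and> (\<forall>x\<in>S. p \<bullet> x \<in> \<int>) \<and> p \<bullet> p \<le> (4/3) ^ r / \<mu>"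
  using assms
proof (induction r arbitrary: S \<mu>)
  case (0 S \<mu>)
  obtain b T where b: "b \<in> S" "b \<noteq> 0" and dT: "dim T = 0"
    and T: "\<And>x. x \<in> S \<Longrightarrow> x - ((x \<bullet> b) / (b \<bullet> b)) *\<^sub>R b \<in> T"
    and int: "\<And>x. x \<in> S \<Longrightarrow> x - ((x \<bullet> b) / (b \<bullet> b)) *\<^sub>R b = 0 \<Longrightarrow> (x \<bullet> b) / (b \<bullet> b) \<in> \<int>"
    using subgroup_projection[OF 0] by metis
  have "T \<subseteq> {0}" using dT by (simp add: dim_eq_0)
  \<comment> \<open>In rank one \<open>S\<close> consists of integer multiples of \<open>b\<close>,
    so b / (b . b) is a dual vector.\<close>
  then have "(b /\<^sub>R (b \<bullet> b)) \<bullet> x \<in> \<int>" if "x \<in> S" for x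
    using int[OF that] T[OF that] by (auto simp: inner_commute divide_inverse mult.commute)
  moreover have "(b /\<^sub>R (b \<bullet> b)) \<bullet> (b /\<^sub>R (b \<bullet> b)) \<le> 1 / \<mu>"
    using b 0(3) 0(4)[OF b] by (simp add: field_simps)
  ultimately show ?case using b
    by (intro bexI[of _ "b /\<^sub>R (b \<bullet> b)"]) (auto intro: span_scale span_base)
next
  case (Suc r S \<mu>)
  obtain b T where b: "b \<in> S" "b \<noteq> 0" and gT: "add_subgroup T" and dT: "dim T = Suc r"
    and TS: "T \<subseteq> span S"
    and T: "\<And>x. x \<in> S \<Longrightarrow> x - ((x \<bullet> b) / (b \<bullet> b)) *\<^sub>R b \<in> T"
    and orth: "\<And>y. y \<in> T \<Longrightarrow> y \<bullet> b = 0"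
    and minT: "\<And>y. y \<in> T \<Longrightarrow> y \<noteq> 0 \<Longrightarrow> 3 / 4 * \<mu> \<le> y \<bullet> y"
    using subgroup_projection[OF Suc.prems] by metis
  obtain p where p: "p \<in> span T" "p \<noteq> 0" "\<forall>x\<in>T. p \<bullet> x \<in> \<int>" "p \<bullet> p \<le> (4/3) ^ r / (3 / 4 * \<mu>)"
    using Suc.IH[OF gT dT _ minT] Suc.prems(3) by auto
  have "orthogonal b p"
    using p(1) by (rule orthogonal_to_span) (simp add: orth orthogonal_def inner_commute)
  then have "p \<bullet> b = 0" by (simp add: orthogonal_def inner_commute)
  then have proj: "p \<bullet> x = p \<bullet> (x - ((x \<bullet> b) / (b \<bullet> b)) *\<^sub>R b)" for x by (simp add: inner_diff_right)
  have "p \<bullet> x \<in> \<int>" if "x \<in> S" for x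
    by (subst proj) (use p(3) T[OF that] in blast)
  moreover have "p \<in> span S" using p(1) TS span_minimal[OF TS subspace_span] by blast
  moreover have "(4/3) ^ r / (3 / 4 * \<mu>) = (4/3) ^ Suc r / \<mu>" by simp
  ultimately show ?case using p by metis
qed

section \<open>Self-dual lattices inside a subspace\<close>

text \<open>Duality is relative to a subspace, so that orthogonal complements of smaller rank stay
  in one ambient type and an induction on the rank is possible.\<close>

definition self_dual_in :: "'a::real_inner set \<Rightarrow> 'a set \<Rightarrow> bool" where
  "self_dual_in V L \<longleftrightarrow> subspace V \<and> L = {y\<in>V. \<forall>x\<in>L. y \<bullet> x \<in> \<int>}"

lemma self_dual_inD:
  assumes "self_dual_in V L"
  shows "subspace V" "L \<subseteq> V" "\<And>x y. x \<in> L \<Longrightarrow> y \<in> L \<Longrightarrow> x \<bullet> y \<in> \<int>"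
    "\<And>y. y \<in> V \<Longrightarrow> (\<And>x. x \<in> L \<Longrightarrow> y \<bullet> x \<in> \<int>) \<Longrightarrow> y \<in> L"
  using assms unfolding self_dual_in_def by blast+

lemma self_dual_in_subgroup:
  assumes "self_dual_in V L"
  shows "add_subgroup L"
proof -
  note sd = self_dual_inD[OF assms]
  show ?thesis unfolding add_subgroup_def
  proof (intro conjI ballI)
    show "0 \<in> L" by (rule sd(4)) (use sd(1) in \<open>auto simp: subspace_0\<close>)
    fix x y assume xy: "x \<in> L" "y \<in> L"
    then have "x - y \<in> V" using sd(1,2) by (auto intro: subspace_diff)
    then show "x - y \<in> L" using sd(3) xy by (intro sd(4)) (auto simp: inner_diff_left)
  qed
qed

text \<open>A vector of V orthogonal to L pairs to 0 with L, and so does every multiple of it. It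
  would then lie in L and be orthogonal to itself.\<close>

lemma self_dual_in_span:
  fixes V :: "'a::euclidean_space set"
  assumes "self_dual_in V L"
  shows "span L = V"
proof (rule ccontr)
  note sd = self_dual_inD[OF assms]
  assume "span L \<noteq> V"
  then have "span L \<subset> span V" using sd(1,2) span_minimal[OF sd(2,1)] by (metis psubsetI span_eq_iff)
  then obtain z where z: "z \<noteq> 0" "z \<in> span V" "\<And>y. y \<in> span L \<Longrightarrow> orthogonal z y"
    using orthogonal_to_subspace_exists_gen[of L V] by blast
  have "z /\<^sub>R (norm z * 2) \<in> L"
  proof (rule sd(4))
    show "z /\<^sub>R (norm z * 2) \<in> V" using z sd(1) by (metis span_eq_iff subspace_scale)
  next
    fix x assume "x \<in> L"
    then show "(z /\<^sub>R (norm z * 2)) \<bullet> x \<in> \<int>" using z(3)[of x] by (simp add: span_base orthogonal_def)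
  qed
  then show False using z(1) z(3)[of "z /\<^sub>R (norm z * 2)"] by (simp add: span_base orthogonal_def)
qed

text \<open>A vector orthogonal to U pairs with x as it does with \<pi> x. A short dual vector of
  the projected group \<pi> L is therefore dual to L, hence in L. The gain over the plain bound is
  that the rank drops by dim U, at the price of bounding the projected norms by \<nu>.\<close>

lemma self_dual_short_orthogonal_vector:
  fixes V :: "'a::euclidean_space set"
  assumes L: "self_dual_in V L" and U: "subspace U" "U \<subseteq> V" "dim V = dim U + Suc r"
    and \<pi>: "linear \<pi>" "\<And>x. x - \<pi> x \<in> U" "\<And>x u. u \<in> U \<Longrightarrow> \<pi> x \<bullet> u = 0"
    and \<nu>: "\<nu> > 0" "\<And>x. x \<in> L \<Longrightarrow> \<pi> x \<noteq> 0 \<Longrightarrow> \<nu> \<le> \<pi> x \<bullet> \<pi> x"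
  obtains z where "z \<in> L" "z \<noteq> 0" "\<And>u. u \<in> U \<Longrightarrow> z \<bullet> u = 0" "z \<bullet> z \<le> (4/3) ^ r / \<nu>"
proof -
  note sd = self_dual_inD[OF L]
  have \<pi>V: "\<pi> x \<in> V" if "x \<in> V" for x
    using subspace_diff[OF sd(1) that, of "x - \<pi> x"] \<pi>(2)[of x] U(2) by auto
  have "\<pi> ` V = {y\<in>V. \<forall>u\<in>U. orthogonal u y}"
  proof (intro equalityI subsetI)
    fix y assume "y \<in> {y\<in>V. \<forall>u\<in>U. orthogonal u y}"
    then have y: "y \<in> V" "\<And>u. u \<in> U \<Longrightarrow> y \<bullet> u = 0" by (auto simp: orthogonal_def inner_commute)
    then have "(y - \<pi> y) \<bullet> (y - \<pi> y) = 0"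
      using \<pi>(2)[of y] \<pi>(3)[of "y - \<pi> y" y] by (simp add: inner_diff_left)
    then show "y \<in> \<pi> ` V" using y(1) by (auto simp: image_iff)
  qed (use \<pi>V \<pi>(3) in \<open>auto simp: orthogonal_def inner_commute\<close>)
  then have "dim (\<pi> ` V) + dim U = dim V"
    using dim_subspace_orthogonal_to_vectors[OF U(1) sd(1) U(2)] by simp
  moreover have spn: "span (\<pi> ` L) = \<pi> ` V"
    using linear_span_image[OF \<pi>(1), of L] self_dual_in_span[OF L] by simp
  ultimately have dim: "dim (\<pi> ` L) = Suc r" using U(3) by (metis add.commute add_left_cancel dim_span)
  have grp: "add_subgroup (\<pi> ` L)"
    using self_dual_in_subgroup[OF L] linear_0[OF \<pi>(1)]
    unfolding add_subgroup_def by (force simp: linear_diff[OF \<pi>(1), symmetric])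
  obtain z where z: "z \<in> span (\<pi> ` L)" "z \<noteq> 0" "\<forall>x\<in>\<pi> ` L. z \<bullet> x \<in> \<int>" "z \<bullet> z \<le> (4/3) ^ r / \<nu>"
    using exists_short_dual_vector[OF grp dim \<nu>(1)] \<nu>(2) by blast
  then obtain v where v: "v \<in> V" "z = \<pi> v" using spn by auto
  have orth: "z \<bullet> u = 0" if "u \<in> U" for u using v \<pi>(3)[OF that] by simp
  have "z \<in> L"
  proof (rule sd(4))
    show "z \<in> V" using v \<pi>V by simp
    fix x assume "x \<in> L"
    moreover have "z \<bullet> x = z \<bullet> \<pi> x" using orth[OF \<pi>(2)[of x]] by (simp add: inner_diff_right)
    ultimately show "z \<bullet> x \<in> \<int>" using z(3) by simp
  qed
  then show thesis using that z orth by blast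
qed

lemma self_dual_short_vector:
  fixes V :: "'a::euclidean_space set"
  assumes L: "self_dual_in V L" and dim: "dim V = Suc r"
    and \<nu>: "\<nu> > 0" "\<And>x. x \<in> L \<Longrightarrow> x \<noteq> 0 \<Longrightarrow> \<nu> \<le> x \<bullet> x"
  obtains z where "z \<in> L" "z \<noteq> 0" "z \<bullet> z \<le> (4/3) ^ r / \<nu>"
proof -
  have "{0} \<subseteq> V" using self_dual_inD(1)[OF L] by (simp add: subspace_0)
  then show thesis
    using self_dual_short_orthogonal_vector[OF L, of "{0}" r "\<lambda>x. x" \<nu>] dim \<nu> that
    by (auto simp: linear_ident)
qed

text \<open>The projection along w has norm x . x - (x . w)^2 / 2, and shifting x by multiples of w
  changes x . w by even numbers. Only x . w = 0 and x . w = 1 remain, which gives the two hypotheses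
  on \<nu>.\<close>

lemma self_dual_short_vector_orthogonal_root:
  fixes V :: "'a::euclidean_space set"
  assumes L: "self_dual_in V L" and dim: "dim V = Suc (Suc r)" and w: "w \<in> L" "w \<bullet> w = 2"
    and \<nu>: "\<nu> > 0" "\<And>x. x \<in> L \<Longrightarrow> x \<noteq> 0 \<Longrightarrow> x \<bullet> w = 0 \<Longrightarrow> \<nu> \<le> x \<bullet> x"
      "\<And>x. x \<in> L \<Longrightarrow> x \<bullet> w = 1 \<Longrightarrow> \<nu> \<le> x \<bullet> x - 1 / 2"
  obtains z where "z \<in> L" "z \<noteq> 0" "z \<bullet> w = 0" "z \<bullet> z \<le> (4/3) ^ r / \<nu>"
proof -
  note sd = self_dual_inD[OF L]
  define \<pi> where "\<pi> = (\<lambda>x. x - ((x \<bullet> w) / 2) *\<^sub>R w)"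
  have lin: "linear \<pi>"
    by (rule linearI) (simp_all add: \<pi>_def inner_add_left algebra_simps add_divide_distrib)
  have "w \<noteq> 0" using w(2) by auto
  then have dimU: "dim (span {w}) = 1" by (simp add: dim_insert)
  have sub: "span {w} \<subseteq> V" using w(1) sd(1,2) by (intro span_minimal) auto
  have bound: "\<nu> \<le> \<pi> x \<bullet> \<pi> x" if x: "x \<in> L" "\<pi> x \<noteq> 0" for x
  proof -
    obtain k where k: "x \<bullet> w = of_int k" using sd(3)[OF x(1) w(1)] by (auto elim: Ints_cases)
    define y where "y = x - of_int (k div 2) *\<^sub>R w"
    have y: "y \<in> L" unfolding y_def using self_dual_in_subgroup[OF L] x w
      by (intro add_subgroup_diff add_subgroup_scaleR_Ints) auto
    have yw: "y \<bullet> w = of_int (k mod 2)"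
    proof -
      have "y \<bullet> w = of_int (k - 2 * (k div 2))" by (simp add: y_def inner_diff_left k w)
      also have "k - 2 * (k div 2) = k mod 2" by presburger
      finally show ?thesis .
    qed
    have "\<pi> w = 0" using w(2) by (simp add: \<pi>_def)
    then have eq: "\<pi> x = \<pi> y" by (simp add: y_def linear_diff[OF lin] linear_scale[OF lin])
    have nrm: "\<pi> y \<bullet> \<pi> y = y \<bullet> y - (y \<bullet> w)\<^sup>2 / 2"
      using w(2) by (simp add: \<pi>_def inner_diff_left inner_diff_right inner_commute[of w y] power2_eq_square)
    have "y \<noteq> 0" using x(2) eq by (auto simp: \<pi>_def)
    consider "k mod 2 = 0" | "k mod 2 = 1" by linarith
    then show ?thesis
    proof cases
      case 1
      then show ?thesis using \<nu>(2)[OF y \<open>y \<noteq> 0\<close>] eq nrm yw by simp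
    next
      case 2
      then show ?thesis using \<nu>(3)[OF y] eq nrm yw by simp
    qed
  qed
  have h1: "\<pi> x \<bullet> u = 0" if u: "u \<in> span {w}" for x u
  proof -
    obtain c where "u = c *\<^sub>R w" using u by (auto simp: span_singleton)
    then show ?thesis using w(2) by (simp add: \<pi>_def inner_diff_left)
  qed
  have h2: "x - \<pi> x \<in> span {w}" for x by (simp add: \<pi>_def span_scale span_base)
  have "dim V = dim (span {w}) + Suc r" using dimU dim by simp
  then obtain z where "z \<in> L" "z \<noteq> 0" "\<And>u. u \<in> span {w} \<Longrightarrow> z \<bullet> u = 0" "z \<bullet> z \<le> (4/3) ^ r / \<nu>"
    using self_dual_short_orthogonal_vector[OF L subspace_span sub _ lin h2 h1 \<nu>(1) bound] by blast
  then show thesis using that by (auto intro: span_base)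
qed

lemma inner_self_int_ge:
  fixes x :: "'a::real_inner"
  assumes "x \<bullet> x \<in> \<int>" "x \<noteq> 0" "x \<bullet> x \<noteq> 1"
  shows "2 \<le> x \<bullet> x"
proof -
  obtain k :: int where k: "x \<bullet> x = of_int k" using assms(1) by (auto elim: Ints_cases)
  have "x \<bullet> x > 0" using assms(2) by simp
  then have "k > 0" "k \<noteq> 1" using assms(3) by (simp_all add: k)
  then show ?thesis by (simp add: k)
qed

text \<open>The roots w and x span a hexagonal lattice A2, whose dual quotient has order 3. Modulo
  A2 the pair (y . w, y . x) can be brought to (0,0), (1,0) or (1,1), where the component in the
  plane has norm 0 or 2/3. The projected minimum is thus at least 2 - 2/3 = 4/3, while the rank
  drops by two.\<close>

lemma self_dual_short_vector_orthogonal_hexagonal: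
  fixes V :: "'a::euclidean_space set"
  assumes L: "self_dual_in V L" and dim: "dim V = Suc (Suc (Suc r))"
    and w: "w \<in> L" "w \<bullet> w = 2" and x: "x \<in> L" "x \<bullet> x = 2" "x \<bullet> w = 1"
    and min: "\<And>y. y \<in> L \<Longrightarrow> y \<noteq> 0 \<Longrightarrow> 2 \<le> y \<bullet> y"
  obtains z where "z \<in> L" "z \<noteq> 0" "z \<bullet> z \<le> (4/3) ^ r / (4/3)"
proof -
  note sd = self_dual_inD[OF L]
  have wx: "w \<bullet> x = 1" using x(3) by (simp add: inner_commute)
  \<comment> \<open>The functionals \<open>a\<close> and \<open>b\<close> come from the inverse of
    the Gram matrix with rows (2, 1) and (1, 2).\<close>
  define a where "a = (\<lambda>y. (2 * (y \<bullet> w) - y \<bullet> x) / 3)"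
  define b where "b = (\<lambda>y. (2 * (y \<bullet> x) - y \<bullet> w) / 3)"
  define \<pi> where "\<pi> = (\<lambda>y. y - a y *\<^sub>R w - b y *\<^sub>R x)"
  have ab: "a (u + v) = a u + a v" "b (u + v) = b u + b v" "a (c *\<^sub>R u) = c * a u" "b (c *\<^sub>R u) = c * b u" for c u v
    by (simp_all add: a_def b_def inner_add_left field_simps)
  have lin: "linear \<pi>"
    by (rule linearI) (simp_all add: \<pi>_def ab algebra_simps)
  have \<pi>w: "\<pi> w = 0" "\<pi> x = 0" using w x wx by (simp_all add: \<pi>_def a_def b_def)
  have "x \<notin> span {w}"
  proof
    assume "x \<in> span {w}"
    then obtain c where "x = c *\<^sub>R w" by (auto simp: span_singleton)
    moreover from this have "c = 1 / 2" using x(3) w(2) by simp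
    ultimately show False using x(2) w(2) by simp
  qed
  moreover have "w \<noteq> 0" using w(2) by auto
  ultimately have dimU: "dim (span {x, w}) = 2" by (simp add: dim_insert)
  have sub: "span {x, w} \<subseteq> V" using w(1) x(1) sd(1,2) by (intro span_minimal) auto
  have "2 * a y + b y = y \<bullet> w" "a y + 2 * b y = y \<bullet> x" for y
    by (simp_all add: a_def b_def field_simps)
  then have \<pi>_orth: "\<pi> y \<bullet> w = 0" "\<pi> y \<bullet> x = 0" for y
    using w(2) x(2,3) wx by (simp_all add: \<pi>_def inner_diff_left algebra_simps)
  have bound: "4/3 \<le> \<pi> y \<bullet> \<pi> y" if y: "y \<in> L" "\<pi> y \<noteq> 0" for y
  proof -
    obtain p where p: "y \<bullet> w = of_int p" using sd(3)[OF y(1) w(1)] by (auto elim: Ints_cases)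
    obtain q where q: "y \<bullet> x = of_int q" using sd(3)[OF y(1) x(1)] by (auto elim: Ints_cases)
    \<comment> \<open>The class of y in the quotient of order 3 is (p + q) mod 3, and (p', q') is
      its representative pair.\<close>
    define t where "t = (p + q) mod 3"
    define s where "s = (p + q) div 3"
    define p' where "p' = (if t \<ge> 1 then 1 else 0 :: int)"
    define q' where "q' = (if t = 2 then 1 else 0 :: int)"
    have t: "t = 0 \<or> t = 1 \<or> t = 2" unfolding t_def by presburger
    have pq: "p + q = 3 * s + p' + q'" using t div_mult_mod_eq[of "p + q" 3]
      by (auto simp: p'_def q'_def simp flip: s_def t_def)
    define y' where "y' = y - of_int (p - p' - s) *\<^sub>R w - of_int (q - q' - s) *\<^sub>R x"
    have y': "y' \<in> L" unfolding y'_def using self_dual_in_subgroup[OF L] x(1) w(1) y(1)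
      by (intro add_subgroup_diff add_subgroup_scaleR_Ints) auto
    have "y' \<bullet> w = of_int (p - 2 * (p - p' - s) - (q - q' - s))"
      by (simp add: y'_def inner_diff_left p w x)
    also have "p - 2 * (p - p' - s) - (q - q' - s) = p'" using pq by simp
    finally have yw: "y' \<bullet> w = of_int p'" .
    have "y' \<bullet> x = of_int (q - (p - p' - s) - 2 * (q - q' - s))"
      by (simp add: y'_def inner_diff_left q w x wx)
    also have "q - (p - p' - s) - 2 * (q - q' - s) = q'" using pq by simp
    finally have yx: "y' \<bullet> x = of_int q'" .
    have eq: "\<pi> y' = \<pi> y" unfolding y'_def by (simp add: linear_diff[OF lin] linear_scale[OF lin] \<pi>w)
    have "y' \<noteq> 0" using y(2) eq linear_0[OF lin] by auto
    have "\<pi> y' \<bullet> \<pi> y' = \<pi> y' \<bullet> y'"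
      by (subst (2) \<pi>_def) (simp add: inner_diff_right \<pi>_orth)
    also have "\<dots> = y' \<bullet> y' - a y' * (y' \<bullet> w) - b y' * (y' \<bullet> x)"
      by (simp add: \<pi>_def inner_diff_left inner_commute[of w y'] inner_commute[of x y'])
    also have "\<dots> = y' \<bullet> y' - (2 * (y' \<bullet> w)\<^sup>2 - 2 * (y' \<bullet> w) * (y' \<bullet> x) + 2 * (y' \<bullet> x)\<^sup>2) / 3"
      by (simp add: a_def b_def field_simps power2_eq_square)
    finally show ?thesis using min[OF y' \<open>y' \<noteq> 0\<close>] t unfolding eq yw yx
      by (auto simp: p'_def q'_def)
  qed
  have h1: "\<pi> y \<bullet> u = 0" if u: "u \<in> span {x, w}" for y u
    using orthogonal_to_span[OF u, of "\<pi> y"] \<pi>_orth by (auto simp: orthogonal_def)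
  have h2: "y - \<pi> y \<in> span {x, w}" for y
    unfolding \<pi>_def by (simp add: span_add span_scale span_base)
  have "dim V = dim (span {x, w}) + Suc r" using dimU dim by simp
  then show thesis
    using self_dual_short_orthogonal_vector[OF L subspace_span sub _ lin h2 h1 _ bound] that
    by (metis zero_less_divide_iff zero_less_numeral)
qed

text \<open>Suppose the minimum is at least 2. Up to rank 5 this contradicts (4/3)^4 < 4. In rank 6
  the bound (4/3)^5 / 2 < 3 still leaves a root w. If some root x has x . w = 1, the hexagonal
  projection yields a vector of norm at most (4/3)^3 / (4/3) = 16/9. Otherwise vectors with inner
  product 1 with w have norm at least 3, the projection along w keeps the minimum 2, and a vector of
  norm at most (4/3)^4 / 2 < 2 appears.\<close>

lemma self_dual_exists_norm_one:
  fixes V :: "'a::euclidean_space set"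
  assumes L: "self_dual_in V L" and dim: "dim V = Suc r" "r \<le> 5"
  shows "\<exists>f\<in>L. f \<bullet> f = 1"
proof (rule ccontr)
  assume no: "\<not> (\<exists>f\<in>L. f \<bullet> f = 1)"
  note sd = self_dual_inD[OF L]
  have min: "2 \<le> y \<bullet> y" if "y \<in> L" "y \<noteq> 0" for y
    using no that sd(3) by (intro inner_self_int_ge) auto
  obtain w where w: "w \<in> L" "w \<noteq> 0" "w \<bullet> w \<le> (4/3) ^ r / 2"
    using self_dual_short_vector[OF L dim(1), of 2] min by auto
  show False
  proof (cases "r = 5")
    case False
    then have "(4/3 :: real) ^ r \<le> (4/3) ^ 4" using dim by (intro power_increasing) auto
    moreover have "(4/3 :: real) ^ 4 < 4" by (simp add: power_divide)
    ultimately have "w \<bullet> w < 2" using w(3) by linarith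
    then show False using min[OF w(1,2)] by simp
  next
    case True
    obtain k :: int where k: "w \<bullet> w = of_int k" using sd(3)[OF w(1) w(1)] by (auto elim: Ints_cases)
    have "w \<bullet> w < 3" using w(3) True by (simp add: power_divide)
    then have "k < 3" "k \<ge> 2" using min[OF w(1,2)] by (simp_all add: k)
    then have w2: "w \<bullet> w = 2" using k by simp
    show False
    proof (cases "\<exists>x\<in>L. x \<bullet> x = 2 \<and> x \<bullet> w = 1")
      case True
      then obtain x where x: "x \<in> L" "x \<bullet> x = 2" "x \<bullet> w = 1" by auto
      obtain z where "z \<in> L" "z \<noteq> 0" "z \<bullet> z \<le> (4/3) ^ 3 / (4/3)"
        using self_dual_short_vector_orthogonal_hexagonal[OF L _ w(1) w2 x min, of 3] dim \<open>r = 5\<close>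
        by auto
      then show False using min[of z] by (simp add: power_divide)
    next
      case False
      have "2 \<le> x \<bullet> x - 1 / 2" if x: "x \<in> L" "x \<bullet> w = 1" for x
      proof -
        obtain k :: int where k: "x \<bullet> x = of_int k" using sd(3)[OF x(1) x(1)] by (auto elim: Ints_cases)
        have "x \<noteq> 0" using x(2) by auto
        then have "k \<ge> 2" "k \<noteq> 2" using min[OF x(1)] False x k by force+
        then show ?thesis by (simp add: k)
      qed
      moreover have "dim V = Suc (Suc 4)" using dim \<open>r = 5\<close> by simp
      ultimately obtain z where "z \<in> L" "z \<noteq> 0" "z \<bullet> z \<le> (4/3) ^ 4 / 2"
        using self_dual_short_vector_orthogonal_root[OF L _ w(1) w2, of 4 2] min by (metis zero_less_numeral)
      then show False using min[of z] by (simp add: power_divide)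
    qed
  qed
qed

text \<open>A vector f of norm one splits off: since x . f is an integer, x - (x . f) f stays in L.
  So the part of L orthogonal to f is again self-dual in its own space.\<close>

lemma self_dual_orthonormal_basis:
  fixes V :: "'a::euclidean_space set"
  assumes "self_dual_in V L" "dim V = n" "n \<le> 6"
  shows "\<exists>F. F \<subseteq> L \<and> finite F \<and> card F = n \<and> pairwise orthogonal F \<and> (\<forall>f\<in>F. f \<bullet> f = 1)"
  using assms
proof (induction n arbitrary: V L)
  case 0
  then show ?case by (intro exI[of _ "{}"]) auto
next
  case (Suc n V L)
  note L = Suc.prems(1)
  note sd = self_dual_inD[OF L]
  obtain f where f: "f \<in> L" "f \<bullet> f = 1" using self_dual_exists_norm_one[OF L, of n] Suc.prems by auto
  define V' where "V' = {y\<in>V. \<forall>x\<in>span {f}. orthogonal x y}"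
  have V': "y \<in> V' \<longleftrightarrow> y \<in> V \<and> y \<bullet> f = 0" for y
    by (auto simp: V'_def span_singleton orthogonal_def inner_commute)
  have "f \<noteq> 0" using f by auto
  then have "dim (span {f}) = 1" by (simp add: dim_insert)
  moreover have "span {f} \<subseteq> V" using f(1) sd(1,2) by (intro span_minimal) auto
  ultimately have dimV': "dim V' = n"
    using dim_subspace_orthogonal_to_vectors[OF subspace_span sd(1), of "{f}"] Suc.prems(2)
    by (simp add: V'_def)
  have "self_dual_in V' (L \<inter> V')"
    unfolding self_dual_in_def
  proof (intro conjI equalityI subsetI)
    show "subspace V'"
      using sd(1) by (auto simp: subspace_def V' inner_add_left)
  next
    fix y assume "y \<in> {y\<in>V'. \<forall>x\<in>L \<inter> V'. y \<bullet> x \<in> \<int>}"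
    then have y: "y \<in> V'" "\<And>x. x \<in> L \<Longrightarrow> x \<in> V' \<Longrightarrow> y \<bullet> x \<in> \<int>" by auto
    have "y \<in> L"
    proof (rule sd(4))
      fix x assume x: "x \<in> L"
      let ?x = "x - (x \<bullet> f) *\<^sub>R f"
      have "?x \<in> L" using self_dual_in_subgroup[OF L] f x sd(3)
        by (intro add_subgroup_diff add_subgroup_scaleR_Ints) auto
      moreover have "?x \<in> V'" using calculation sd(2) f(2) by (auto simp: V' inner_diff_left)
      ultimately have "y \<bullet> ?x \<in> \<int>" by (rule y(2))
      then show "y \<bullet> x \<in> \<int>" using y(1) by (simp add: V' inner_diff_right)
    qed (use y V' in auto)
    then show "y \<in> L \<inter> V'" using y by simp
  qed (use sd(3) in auto)
  then obtain F where F: "F \<subseteq> L \<inter> V'" "finite F" "card F = n" "pairwise orthogonal F" "\<forall>f\<in>F. f \<bullet> f = 1"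
    using Suc.IH[of V' "L \<inter> V'"] dimV' Suc.prems(3) by auto
  have orth: "orthogonal g f" "orthogonal f g" if "g \<in> F" for g
    using F(1) V' that by (auto simp: orthogonal_def inner_commute)
  then have "f \<notin> F" using f by (fastforce simp: orthogonal_def)
  then show ?case using F f orth
    by (intro exI[of _ "insert f F"])
       (auto simp: pairwise_insert)
qed

section \<open>Coordinates on even unimodular lattices of rank 8\<close>

lemma half_odd_of_double_Ints:
  fixes a :: real
  assumes "2 * a \<in> \<int>" "a \<notin> \<int>"
  shows "a - 1/2 \<in> \<int>"
proof -
  obtain k where k: "2 * a = of_int k" using assms(1) by (auto elim: Ints_cases)
  have "odd k" using assms(2) k by (auto elim!: evenE)
  then obtain j where "k = 2 * j + 1" by (auto elim: oddE)
  then have "a - 1/2 = of_int j" using k by simp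
  then show ?thesis by simp
qed

lemma D8_pair_in:
  fixes E :: "'a::real_vector set"
  assumes "add_subgroup E" "f + g \<in> E" "f - g \<in> E" "even (k + l)"
  shows "of_int k *\<^sub>R f + of_int l *\<^sub>R g \<in> E"
proof -
  obtain m where m: "k + l = 2 * m" using assms(4) by (rule evenE)
  have "of_int m *\<^sub>R (f + g) + of_int (k - m) *\<^sub>R (f - g) \<in> E"
    by (intro add_subgroup_add[OF assms(1)] add_subgroup_scaleR_Ints[OF assms(1)] assms Ints_of_int)
  moreover have "m - (k - m) = l" using m by simp
  then have "(of_int m :: real) - (of_int k - of_int m) = of_int l" by (metis of_int_diff)
  then have "of_int m *\<^sub>R (f + g) + of_int (k - m) *\<^sub>R (f - g) = of_int k *\<^sub>R f + of_int l *\<^sub>R g"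
    by (simp add: algebra_simps flip: scaleR_add_left)
  ultimately show ?thesis by simp
qed

text \<open>The neighbour of \<open>E\<close> along \<open>f\<close> splits off \<open>f\<close> and \<open>g\<close>; its orthogonal complement is unimodular.\<close>

lemma neighbour_self_dual:
  fixes E :: "'a::euclidean_space set"
  assumes E: "self_dual_in UNIV E" and fg: "f \<bullet> f = 1" "g \<bullet> g = 1" "f \<bullet> g = 0" "f + g \<in> E" "f - g \<in> E"
  defines "V \<equiv> {y. y \<bullet> f = 0 \<and> y \<bullet> g = 0}"
  shows "self_dual_in V {y\<in>V. y \<in> E \<or> y + f \<in> E}" (is "self_dual_in V ?N")
    and "dim V + 2 = DIM('a)"
proof -
  note sd = self_dual_inD[OF E]
  note grp = self_dual_in_subgroup[OF E]
  have gf: "g \<bullet> f = 0" using fg by (simp add: inner_commute)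
  have V: "y \<bullet> f = 0" "y \<bullet> g = 0" "f \<bullet> y = 0" "g \<bullet> y = 0" if "y \<in> V" for y
    using that by (auto simp: V_def inner_commute)
  have two_f: "2 *\<^sub>R f \<in> E" using D8_pair_in[OF grp fg(4,5), of 2 0] by simp
  show "self_dual_in V ?N" unfolding self_dual_in_def
  proof (intro conjI equalityI subsetI)
    show "subspace V" by (auto simp: V_def subspace_def inner_add_left)
  next
    fix y assume y: "y \<in> ?N"
    have "y \<bullet> x \<in> \<int>" if x: "x \<in> ?N" for x
    proof -
      have xv: "x \<in> V" "y \<in> V" using x y by auto
      consider "x \<in> E" "y \<in> E" | "x + f \<in> E" "y \<in> E" | "x \<in> E" "y + f \<in> E" | "x + f \<in> E" "y + f \<in> E"
        using x y by auto
      then show ?thesis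
      proof cases
        case 1 then show ?thesis using sd(3) by blast
      next
        case 2 then show ?thesis using sd(3)[of y "x + f"] V xv by (simp add: inner_add_right)
      next
        case 3 then show ?thesis using sd(3)[of "y + f" x] V xv by (simp add: inner_add_left)
      next
        case 4
        then have "(y + f) \<bullet> (x + f) \<in> \<int>" using sd(3) by blast
        then have "y \<bullet> x + 1 \<in> \<int>" using V xv fg by (simp add: inner_add_left inner_add_right)
        then show ?thesis by (metis Ints_1 Ints_diff add_diff_cancel_right')
      qed
    qed
    then show "y \<in> {y \<in> V. \<forall>x\<in>?N. y \<bullet> x \<in> \<int>}" using y by auto
  next
    fix y assume "y \<in> {y \<in> V. \<forall>x\<in>?N. y \<bullet> x \<in> \<int>}"
    then have y: "y \<in> V" "\<And>x. x \<in> ?N \<Longrightarrow> y \<bullet> x \<in> \<int>" by auto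
    \<comment> \<open>Such an x has integral coordinates along f and g. Removing them leaves p in V,
      and the parity of k + l decides whether p or p + f lies in E.\<close>
    have int: "y \<bullet> x \<in> \<int>" if x: "x \<in> E" "x \<bullet> f \<in> \<int>" for x
    proof -
      obtain k where k: "x \<bullet> f = of_int k" using x(2) by (auto elim: Ints_cases)
      have "x \<bullet> (f + g) \<in> \<int>" using sd(3) x(1) fg(4) by blast
      then have "x \<bullet> g \<in> \<int>" using x(2) by (metis Ints_diff add_diff_cancel_left' inner_add_right)
      then obtain l where l: "x \<bullet> g = of_int l" by (auto elim: Ints_cases)
      define p where "p = x - (of_int k *\<^sub>R f + of_int l *\<^sub>R g)"
      have pV: "p \<in> V" using fg gf by (simp add: V_def p_def inner_diff_left inner_add_left k l)
      have "p \<in> ?N"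
      proof (cases "even (k + l)")
        case True
        then have "p \<in> E" unfolding p_def
          using D8_pair_in[OF grp fg(4,5)] x grp by (intro add_subgroup_diff) auto
        then show ?thesis using pV by simp
      next
        case False
        then have "even ((k - 1) + l)" by simp
        then have "x - (of_int (k - 1) *\<^sub>R f + of_int l *\<^sub>R g) \<in> E"
          using D8_pair_in[OF grp fg(4,5)] x(1) by (intro add_subgroup_diff[OF grp]) blast+
        moreover have "x - (of_int (k - 1) *\<^sub>R f + of_int l *\<^sub>R g) = p + f"
          by (simp add: p_def algebra_simps)
        ultimately show ?thesis using pV by simp
      qed
      then have "y \<bullet> p \<in> \<int>" by (rule y(2))
      then show ?thesis using V[OF y(1)] by (simp add: p_def inner_diff_right inner_add_right)
    qed
    show "y \<in> ?N"
    proof (cases "\<forall>x\<in>E. y \<bullet> x \<in> \<int>")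
      case True
      then show ?thesis using sd(4)[of y] y(1) by auto
    next
      \<comment> \<open>Integrality of y can now fail only where x . f is not an integer. There both
        y . x and f . x are half odd, so y + f pairs integrally with all of E.\<close>
      case False
      then obtain x0 where x0: "x0 \<in> E" "y \<bullet> x0 \<notin> \<int>" by auto
      have dbl: "2 * (x \<bullet> f) \<in> \<int>" if "x \<in> E" for x
        using sd(3)[OF that two_f] by simp
      have half: "x \<bullet> f - 1/2 \<in> \<int>" if "x \<in> E" "y \<bullet> x \<notin> \<int> \<or> x \<bullet> f \<notin> \<int>" for x
        using half_odd_of_double_Ints[OF dbl[OF that(1)]] int that by blast
      have "2 *\<^sub>R x0 \<in> E" using grp x0(1) by (intro add_subgroup_scaleR_Ints) auto
      then have "2 * (y \<bullet> x0) \<in> \<int>" using int[of "2 *\<^sub>R x0"] dbl[OF x0(1)] by simp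
      then have y0: "y \<bullet> x0 - 1/2 \<in> \<int>" using half_odd_of_double_Ints x0(2) by blast
      have "y + f \<in> E"
      proof (rule sd(4))
        fix x assume x: "x \<in> E"
        show "(y + f) \<bullet> x \<in> \<int>"
        proof (cases "x \<bullet> f \<in> \<int>")
          case True
          then show ?thesis using int[OF x] by (simp add: inner_add_left inner_commute[of f])
        next
          case False
          then have xf: "x \<bullet> f - 1/2 \<in> \<int>" using half x by blast
          have "x0 \<bullet> f - 1/2 \<in> \<int>" using half x0 by blast
          then have "(x - x0) \<bullet> f \<in> \<int>" using xf Ints_diff[OF xf, of "x0 \<bullet> f - 1/2"]
            by (simp add: inner_diff_left)
          then have "y \<bullet> (x - x0) \<in> \<int>" using int[of "x - x0"] add_subgroup_diff[OF grp x x0(1)] by blast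
          then have "y \<bullet> (x - x0) + (y \<bullet> x0 - 1/2) + (x \<bullet> f - 1/2) + 1 \<in> \<int>"
            by (intro Ints_add y0 xf) auto
          moreover have "y \<bullet> (x - x0) + (y \<bullet> x0 - 1/2) + (x \<bullet> f - 1/2) + 1 = (y + f) \<bullet> x"
            by (simp add: inner_diff_right inner_add_left inner_commute[of f])
          ultimately show ?thesis by simp
        qed
      qed simp
      then show ?thesis using y(1) by simp
    qed
  qed
  have "f \<noteq> 0" "g \<noteq> 0" using fg by auto
  moreover have "f \<notin> span {g}" using fg by (auto simp: span_singleton)
  ultimately have "dim (span {f, g}) = 2" by (simp add: dim_insert)
  moreover have "V = {y \<in> UNIV. \<forall>x\<in>span {f, g}. orthogonal x y}"
  proof (intro equalityI subsetI)
    fix y assume y: "y \<in> V"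
    have "orthogonal y x" if "x \<in> span {f, g}" for x
      using that by (rule orthogonal_to_span) (use V[OF y] in \<open>auto simp: orthogonal_def\<close>)
    then show "y \<in> {y \<in> UNIV. \<forall>x\<in>span {f, g}. orthogonal x y}" by (simp add: orthogonal_commute)
  qed (auto simp: V_def orthogonal_def inner_commute span_base)
  ultimately show "dim V + 2 = DIM('a)"
    using dim_subspace_orthogonal_to_vectors[OF subspace_span subspace_UNIV, of "{f, g}"] by simp
qed

text \<open>Nonzero norms are 2 or at least 4, and the bound (4/3)^7 / 2 lies below 4. The
  projection along the first root has minimum at least 2 - 1/2 = 3/2 in rank 7, and (4/3)^6 / (3/2)
  is the same number.\<close>

lemma even_unimodular_orthogonal_roots:
  fixes E :: "'a::euclidean_space set"
  assumes E: "self_dual_in UNIV E" and even: "\<And>x. x \<in> E \<Longrightarrow> \<exists>k::int. x \<bullet> x = 2 * of_int k"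
    and dim: "DIM('a) = 8"
  obtains v w where "v \<in> E" "w \<in> E" "v \<bullet> v = 2" "w \<bullet> w = 2" "v \<bullet> w = 0"
proof -
  have min: "2 \<le> x \<bullet> x" if "x \<in> E" "x \<noteq> 0" for x
  proof -
    obtain k :: int where k: "x \<bullet> x = 2 * of_int k" using even[OF \<open>x \<in> E\<close>] by blast
    then have "(0::real) < 2 * of_int k" using that by (metis inner_gt_zero_iff)
    then show ?thesis by (simp add: k)
  qed
  have root: "x \<bullet> x = 2" if "x \<in> E" "x \<noteq> 0" "x \<bullet> x < 4" for x
  proof -
    obtain k :: int where k: "x \<bullet> x = 2 * of_int k" using even[OF \<open>x \<in> E\<close>] by blast
    then show ?thesis using min[of x] that by simp
  qed
  obtain v where v: "v \<in> E" "v \<noteq> 0" "v \<bullet> v \<le> (4/3) ^ 7 / 2"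
    using self_dual_short_vector[OF E, of 7 2] min dim by auto
  then have v2: "v \<bullet> v = 2" using root[of v] by (simp add: power_divide)
  have "3/2 \<le> x \<bullet> x - 1/2" if "x \<in> E" "x \<bullet> v = 1" for x
    using min[of x] that by force
  moreover have "3/2 \<le> x \<bullet> x" if "x \<in> E" "x \<noteq> 0" for x using min[OF that] by simp
  moreover have "dim (UNIV :: 'a set) = Suc (Suc 6)" using dim by simp
  ultimately obtain w where w: "w \<in> E" "w \<noteq> 0" "w \<bullet> v = 0" "w \<bullet> w \<le> (4/3) ^ 6 / (3/2)"
    using self_dual_short_vector_orthogonal_root[OF E _ v(1) v2, of 6 "3/2"] by auto
  then have "w \<bullet> w = 2" using root[of w] by (simp add: power_divide)
  then show thesis using that[of v w] v w v2 by (simp add: inner_commute)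
qed

lemma even_unimodular_orthonormal_set:
  fixes E :: "'a::euclidean_space set"
  assumes E: "self_dual_in UNIV E" and even: "\<And>x. x \<in> E \<Longrightarrow> \<exists>k::int. x \<bullet> x = 2 * of_int k"
    and dim: "DIM('a) = 8"
  obtains B where "finite B" "card B = 8" "pairwise orthogonal B" "\<And>b. b \<in> B \<Longrightarrow> b \<bullet> b = 1"
    "\<And>b c. b \<in> B \<Longrightarrow> c \<in> B \<Longrightarrow> b + c \<in> E"
proof -
  note grp = self_dual_in_subgroup[OF E]
  obtain v w where vw: "v \<in> E" "w \<in> E" "v \<bullet> v = 2" "w \<bullet> w = 2" "v \<bullet> w = 0"
    using even_unimodular_orthogonal_roots[OF E even dim] by blast
  have wv: "w \<bullet> v = 0" using vw by (simp add: inner_commute)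
  define f where "f = (v + w) /\<^sub>R 2"
  define g where "g = (v - w) /\<^sub>R 2"
  have fg: "f \<bullet> f = 1" "g \<bullet> g = 1" "f \<bullet> g = 0"
    using vw wv by (simp_all add: f_def g_def inner_add_left inner_add_right inner_diff_left inner_diff_right)
  have fg': "f + g = v" "f - g = w"
    by (simp_all add: f_def g_def algebra_simps flip: scaleR_add_left)
  define V where "V = {y. y \<bullet> f = 0 \<and> y \<bullet> g = 0}"
  define N where "N = {y\<in>V. y \<in> E \<or> y + f \<in> E}"
  have sdN: "self_dual_in V N" and dimV: "dim V = 6"
    using neighbour_self_dual[OF E fg] vw dim by (simp_all add: V_def N_def fg')
  obtain F where F: "F \<subseteq> N" "finite F" "card F = 6" "pairwise orthogonal F" "\<forall>f\<in>F. f \<bullet> f = 1"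
    using self_dual_orthonormal_basis[OF sdN dimV] by auto
  have orth: "b \<bullet> f = 0" "b \<bullet> g = 0" "f \<bullet> b = 0" "g \<bullet> b = 0" if "b \<in> F" for b
    using that F(1) by (auto simp: N_def V_def inner_commute)
  have nf: "f \<notin> F" "g \<notin> F" "f \<noteq> g" using orth(1)[of f] orth(2)[of g] fg by auto
  have not_E: "b \<notin> E" if "b \<bullet> b = 1" for b
  proof
    assume "b \<in> E"
    then obtain k :: int where "b \<bullet> b = 2 * of_int k" using even by blast
    then have "1 = 2 * k" using \<open>b \<bullet> b = 1\<close> by linarith
    then show False by presburger
  qed
  \<comment> \<open>A vector of norm one is not in the even lattice E, so it belongs to N through
    the other coset. This is why sums of two frame vectors land in E.\<close>
  have plus: "f + b \<in> E" if "b \<in> F" for b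
    using that F(1,5) not_E[of b] by (auto simp: N_def add.commute)
  have minus: "f - b \<in> E" if "b \<in> F" for b
  proof -
    have "- b \<in> N" using add_subgroup_uminus[OF self_dual_in_subgroup[OF sdN]] F(1) that by auto
    then show ?thesis using F(5) that not_E[of "- b"] by (auto simp: N_def add.commute)
  qed
  have pm: "f + b \<in> E \<and> f - b \<in> E" if "b \<in> insert g F" for b
    using that plus minus vw fg' by auto
  have "f + f = v + w" by (simp add: f_def flip: scaleR_2)
  then have two_f: "f + f \<in> E" using add_subgroup_add[OF grp vw(1,2)] by simp
  have "b + c \<in> E" if "b \<in> insert f (insert g F)" "c \<in> insert f (insert g F)" for b c
  proof -
    have "f + x \<in> E" "f - x \<in> E" if "x \<in> insert f (insert g F)" for x
      using that pm two_f grp by (auto simp: add_subgroup_def)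
    then have "(f + b) - (f - c) \<in> E" using that add_subgroup_diff[OF grp] by blast
    then show ?thesis by (simp add: algebra_simps)
  qed
  moreover have "pairwise orthogonal (insert f (insert g F))"
    using F(4) orth fg nf by (auto simp: pairwise_insert orthogonal_def inner_commute)
  ultimately show thesis using that[of "insert f (insert g F)"] F nf fg by auto
qed

section \<open>From an orthonormal set to explicit coordinates\<close>

lemma add_subgroup_sum:
  assumes "add_subgroup S" "\<And>i. i \<in> I \<Longrightarrow> g i \<in> S"
  shows "(\<Sum>i\<in>I. g i) \<in> S"
  using assms(2)
proof (induction I rule: infinite_finite_induct)
  case (insert i I)
  then show ?case using add_subgroup_add[OF assms(1)] by simp
qed (use assms(1) in \<open>auto simp: add_subgroup_def\<close>)

text \<open>The case i = j is included, so E contains 2 f i and hence every f i - f j: the condition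
  says that E contains the D8 root lattice of the frame.\<close>

definition D8_frame :: "'a::real_inner set \<Rightarrow> (8 \<Rightarrow> 'a) \<Rightarrow> bool" where
  "D8_frame E f \<longleftrightarrow> (\<forall>i j. f i \<bullet> f j = of_bool (i = j)) \<and> (\<forall>i j. f i + f j \<in> E)"

lemma D8_frame_expand:
  fixes f :: "8 \<Rightarrow> 'a::euclidean_space"
  assumes f: "D8_frame E f" and dim: "DIM('a) = 8"
  shows "(\<Sum>i\<in>UNIV. (x \<bullet> f i) *\<^sub>R f i) = x"
proof -
  have ff: "f i \<bullet> f j = of_bool (i = j)" for i j using f by (simp add: D8_frame_def)
  have inj: "inj f"
    by (rule injI) (metis ff of_bool_eq(1) of_bool_eq(2) zero_neq_one)
  have orth: "pairwise orthogonal (range f)"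
    by (auto simp: pairwise_def orthogonal_def ff)
  have nrm: "norm v = 1" if "v \<in> range f" for v using that by (auto simp: norm_eq_sqrt_inner ff)
  then have "0 \<notin> range f" by (metis norm_zero zero_neq_one)
  then have "independent (range f)" using orth by (intro pairwise_orthogonal_independent)
  moreover have "card (range f) = DIM('a)" using inj dim by (simp add: card_image)
  ultimately have "span (range f) = UNIV"
    using card_eq_dim[of "range f" UNIV] by auto
  then have "(\<Sum>v\<in>range f. (x \<bullet> v) *\<^sub>R v) = x"
    using orth nrm by (intro orthonormal_basis_expand) auto
  then show ?thesis by (simp add: sum.reindex[OF inj])
qed

lemma D8_frame_inner_sum:
  assumes "D8_frame E f"
  shows "(\<Sum>i\<in>UNIV. c i *\<^sub>R f i) \<bullet> f j = c j"
    and "(\<Sum>i\<in>UNIV. c i *\<^sub>R f i) \<bullet> (\<Sum>i\<in>UNIV. d i *\<^sub>R f i) = (\<Sum>i\<in>UNIV. c i * d i)"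
proof -
  show *: "(\<Sum>i\<in>UNIV. c i *\<^sub>R f i) \<bullet> f j = c j" for c j
  proof -
    have "c i * (f i \<bullet> f j) = (if i = j then c i else 0)" for i
      using assms by (simp add: D8_frame_def)
    then show ?thesis by (simp add: inner_sum_left)
  qed
  show "(\<Sum>i\<in>UNIV. c i *\<^sub>R f i) \<bullet> (\<Sum>i\<in>UNIV. d i *\<^sub>R f i) = (\<Sum>i\<in>UNIV. c i * d i)"
    by (subst inner_sum_right) (simp add: * mult.commute)
qed

text \<open>Moving all coefficients to the index 0 writes the vector as a combination of differences
  f i - f 0 and a multiple of 2 f 0.\<close>

lemma D8_frame_even_sum_in:
  assumes grp: "add_subgroup E" and f: "D8_frame E f" and "even (\<Sum>i\<in>UNIV. n i)"
  shows "(\<Sum>i\<in>UNIV. of_int (n i) *\<^sub>R f i) \<in> E"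
proof -
  have plus: "f i + f j \<in> E" for i j using f by (simp add: D8_frame_def)
  then have minus: "f i - f j \<in> E" for i j
    using add_subgroup_diff[OF grp plus[of i j] plus[of j j]] by simp
  obtain m where m: "(\<Sum>i\<in>UNIV. n i) = 2 * m" using assms(3) by (rule evenE)
  have "(\<Sum>i\<in>UNIV. of_int (n i) *\<^sub>R (f i - f 0)) + of_int m *\<^sub>R (f 0 + f 0) \<in> E"
    by (intro add_subgroup_add[OF grp] add_subgroup_sum[OF grp] add_subgroup_scaleR_Ints[OF grp]
        plus minus Ints_of_int)
  moreover have "of_int m *\<^sub>R (f 0 + f 0) = (\<Sum>i\<in>UNIV. of_int (n i) *\<^sub>R f 0)"
  proof -
    have "(\<Sum>i\<in>UNIV. of_int (n i) *\<^sub>R f 0) = of_int (\<Sum>i\<in>UNIV. n i) *\<^sub>R f 0"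
      by (simp add: scaleR_sum_left)
    then show ?thesis by (simp add: m algebra_simps flip: scaleR_2)
  qed
  ultimately show ?thesis by (simp add: scaleR_diff_right sum_subtractf)
qed

lemma even_sum_squares: "even (\<Sum>i\<in>I. (n i)\<^sup>2) \<longleftrightarrow> even (\<Sum>i\<in>I. n i :: int)"
  by (induction I rule: infinite_finite_induct) auto

text \<open>Flipping the sign of one frame vector if necessary puts the glue vector
  \<open>(f\<^sub>1 + \<dots> + f\<^sub>8) / 2\<close> into the lattice.\<close>

lemma even_unimodular_glue_frame:
  fixes E :: "'a::euclidean_space set"
  assumes E: "self_dual_in UNIV E" and even: "\<And>x. x \<in> E \<Longrightarrow> \<exists>k::int. x \<bullet> x = 2 * of_int k"
    and dim: "DIM('a) = 8"
  obtains f where "D8_frame E f" "(\<Sum>i\<in>UNIV. (1/2) *\<^sub>R f i) \<in> E"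
proof -
  note sd = self_dual_inD[OF E]
  note grp = self_dual_in_subgroup[OF E]
  obtain B where B: "finite B" "card B = 8" "pairwise orthogonal B" "\<And>b. b \<in> B \<Longrightarrow> b \<bullet> b = 1"
    "\<And>b c. b \<in> B \<Longrightarrow> c \<in> B \<Longrightarrow> b + c \<in> E"
    using even_unimodular_orthonormal_set[OF E even dim] by metis
  obtain f :: "8 \<Rightarrow> 'a" where f: "bij_betw f UNIV B"
    using B finite_same_card_bij[of "UNIV :: 8 set" B] by auto
  have fB: "f i \<in> B" for i using f by (auto simp: bij_betw_def)
  have frame: "D8_frame E f"
    unfolding D8_frame_def
  proof (intro conjI allI)
    fix i j show "f i \<bullet> f j = of_bool (i = j)"
      using B(4)[OF fB[of i]] pairwiseD[OF B(3) fB[of i] fB[of j]] injD[OF bij_betw_imp_inj_on[OF f], of i j]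
      by (cases "i = j") (auto simp: orthogonal_def)
  qed (use fB B(5) in auto)
  define s where "s = (\<Sum>i\<in>UNIV. (1/2) *\<^sub>R f i)"
  show thesis
  proof (cases "s \<in> E")
    case True
    then show thesis using that frame by (simp add: s_def)
  next
    case False
    then obtain x where x: "x \<in> E" "s \<bullet> x \<notin> \<int>" using sd(4)[of s] by auto
    have xs: "s \<bullet> x = (\<Sum>i\<in>UNIV. x \<bullet> f i) / 2"
      by (simp add: s_def inner_sum_right inner_commute[of _ x] sum_divide_distrib)
    have two_f: "2 *\<^sub>R f i \<in> E" for i
      unfolding scaleR_2 using frame unfolding D8_frame_def by blast
    have dbl: "2 * (x \<bullet> f i) \<in> \<int>" for i using sd(3)[OF x(1) two_f] by simp
    have xsum: "x \<bullet> f i + x \<bullet> f j \<in> \<int>" for i j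
      using sd(3)[OF x(1), of "f i + f j"] frame by (simp add: D8_frame_def inner_add_right)
    \<comment> \<open>Integral coordinates would have an even sum because x has even norm, and then
      s . x would be an integer.\<close>
    have "\<exists>k. x \<bullet> f k \<notin> \<int>"
    proof (rule ccontr)
      assume "\<nexists>k. x \<bullet> f k \<notin> \<int>"
      then have "\<forall>i. \<exists>n::int. x \<bullet> f i = of_int n" by (metis Ints_cases)
      then obtain n :: "8 \<Rightarrow> int" where n: "\<And>i. x \<bullet> f i = of_int (n i)" by metis
      have "x \<bullet> x = (\<Sum>i\<in>UNIV. (x \<bullet> f i) * (x \<bullet> f i))"
        using D8_frame_inner_sum(2)[OF frame, of "\<lambda>i. x \<bullet> f i" "\<lambda>i. x \<bullet> f i"]
        by (simp add: D8_frame_expand[OF frame dim])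
      also have "\<dots> = of_int (\<Sum>i\<in>UNIV. (n i)\<^sup>2)" by (simp add: n power2_eq_square)
      finally have "x \<bullet> x = of_int (\<Sum>i\<in>UNIV. (n i)\<^sup>2)" .
      moreover obtain k :: int where "x \<bullet> x = 2 * of_int k" using even x(1) by blast
      ultimately have "(\<Sum>i\<in>UNIV. (n i)\<^sup>2) = 2 * k" by linarith
      then have "even (\<Sum>i\<in>UNIV. n i)" using even_sum_squares[of n UNIV] by simp
      then obtain m where "(\<Sum>i\<in>UNIV. n i) = 2 * m" by (rule evenE)
      then have "s \<bullet> x = of_int m" using xs by (simp add: n flip: of_int_sum)
      then show False using x(2) by simp
    qed
    then obtain k where k: "x \<bullet> f k \<notin> \<int>" by blast
    have "x \<bullet> f i - 1/2 \<in> \<int>" for i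
    proof -
      have "x \<bullet> f i \<notin> \<int>" using k xsum[of i k] by (metis Ints_diff add_diff_cancel_left')
      then show ?thesis using half_odd_of_double_Ints dbl by blast
    qed
    then have "\<forall>i. \<exists>n::int. x \<bullet> f i - 1/2 = of_int n" by (metis Ints_cases)
    then obtain n :: "8 \<Rightarrow> int" where n: "\<And>i. x \<bullet> f i - 1/2 = of_int (n i)" by metis
    then have n': "x \<bullet> f i = of_int (n i) + 1/2" for i by (metis diff_eq_eq)
    have x_eq: "x = (\<Sum>i\<in>UNIV. of_int (n i) *\<^sub>R f i) + s"
      by (subst D8_frame_expand[OF frame dim, of x, symmetric])
        (simp add: n' scaleR_add_left sum.distrib s_def)
    have odd: "odd (\<Sum>i\<in>UNIV. n i)"
    proof
      assume "even (\<Sum>i\<in>UNIV. n i)"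
      then have "x - (\<Sum>i\<in>UNIV. of_int (n i) *\<^sub>R f i) \<in> E"
        by (intro add_subgroup_diff[OF grp] x D8_frame_even_sum_in[OF grp frame])
      then show False using False x_eq by (metis add_diff_cancel_left')
    qed
    \<comment> \<open>Raising one coefficient by 1 makes the sum even. The remainder s - f 0 is s
      with the sign of its coordinate at 0 reversed.\<close>
    define n2 where "n2 = n(0 := n 0 + 1)"
    have upd: "(\<Sum>i\<in>UNIV. h (n2 i) i) = (\<Sum>i\<in>UNIV. h (n i) i) - h (n 0) 0 + h (n 0 + 1) 0"
      for h :: "int \<Rightarrow> 8 \<Rightarrow> 'b::ab_group_add"
      by (simp add: sum.remove[of UNIV "0::8"] n2_def)
    have "even (\<Sum>i\<in>UNIV. n2 i)" using odd upd[of "\<lambda>a i. a"] by simp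
    then have "x - (\<Sum>i\<in>UNIV. of_int (n2 i) *\<^sub>R f i) \<in> E"
      by (intro add_subgroup_diff[OF grp] x D8_frame_even_sum_in[OF grp frame])
    moreover have "x - (\<Sum>i\<in>UNIV. of_int (n2 i) *\<^sub>R f i) = s - f 0"
      using upd[of "\<lambda>a i. of_int a *\<^sub>R f i"] by (subst x_eq) (simp add: scaleR_add_left)
    ultimately have sE: "s - f 0 \<in> E" by simp
    define g where "g = f(0 := - f 0)"
    have "(\<Sum>i\<in>UNIV. (1/2) *\<^sub>R g i) = s - f 0"
      by (simp add: sum.remove[of UNIV "0::8"] g_def s_def algebra_simps)
        (simp flip: scaleR_add_left)
    moreover have "D8_frame E g"
      unfolding D8_frame_def
    proof (intro conjI allI)
      fix i j show "g i \<bullet> g j = of_bool (i = j)" using frame by (auto simp: g_def D8_frame_def)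
      have plus: "f i + f j \<in> E" for i j using frame by (simp add: D8_frame_def)
      then have minus: "f i - f j \<in> E" for i j
        using add_subgroup_diff[OF grp plus[of i j] plus[of j j]] by simp
      show "g i + g j \<in> E"
        using plus minus[of j 0] minus[of i 0] add_subgroup_uminus[OF grp plus[of 0 0]] by (auto simp: g_def)
    qed
    ultimately show thesis using that sE by metis
  qed
qed

definition D8_lattice :: "(8 \<Rightarrow> 'a::real_vector) \<Rightarrow> 'a set" where
  "D8_lattice f = {\<Sum>i\<in>UNIV. of_int (n i) *\<^sub>R f i | n. even (\<Sum>i\<in>UNIV. n i)}"

text \<open>The z i are numerators over 2, which keeps later moments integral. Divisibility by 4
  says that the coordinate sum is even, as it must be for a translate by (1/2, ..., 1/2), whose
  coordinate sum is 4.\<close>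

definition D8_glue :: "(8 \<Rightarrow> 'a::real_vector) \<Rightarrow> 'a set" where
  "D8_glue f = {\<Sum>i\<in>UNIV. (of_int (z i) / 2) *\<^sub>R f i | z. (\<forall>i. odd (z i)) \<and> 4 dvd (\<Sum>i\<in>UNIV. z i)}"

text \<open>Integrality of x . (f i + f j) makes the coordinates of x all integral or all half odd.
  In the first case even norm forces an even coordinate sum; the second reduces to the first by
  subtracting the glue vector.\<close>

lemma even_unimodular_E8_coordinates:
  fixes E :: "'a::euclidean_space set"
  assumes E: "self_dual_in UNIV E" and even: "\<And>x. x \<in> E \<Longrightarrow> \<exists>k::int. x \<bullet> x = 2 * of_int k"
    and dim: "DIM('a) = 8"
  obtains f where "D8_frame E f" "E = D8_lattice f \<union> D8_glue f"
proof -
  note sd = self_dual_inD[OF E]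
  note grp = self_dual_in_subgroup[OF E]
  obtain f where frame: "D8_frame E f" and s: "(\<Sum>i\<in>UNIV. (1/2) *\<^sub>R f i) \<in> E"
    using even_unimodular_glue_frame[OF E even dim] by blast
  define s where "s = (\<Sum>i\<in>UNIV. (1/2) *\<^sub>R f i)"
  have D: "x \<in> D8_lattice f" if xE: "x \<in> E" and int: "\<forall>i. x \<bullet> f i \<in> \<int>" for x
  proof -
    have "\<forall>i. \<exists>n::int. x \<bullet> f i = of_int n" using int by (metis Ints_cases)
    then obtain n :: "8 \<Rightarrow> int" where n: "\<And>i. x \<bullet> f i = of_int (n i)" by metis
    have x: "x = (\<Sum>i\<in>UNIV. of_int (n i) *\<^sub>R f i)"
      using D8_frame_expand[OF frame dim, of x] by (simp add: n)
    have "x \<bullet> x = of_int (\<Sum>i\<in>UNIV. (n i)\<^sup>2)"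
      unfolding arg_cong2[where f = inner, OF x x] D8_frame_inner_sum(2)[OF frame]
      by (simp add: power2_eq_square)
    moreover obtain k :: int where "x \<bullet> x = 2 * of_int k" using even[OF xE] by blast
    ultimately have "(\<Sum>i\<in>UNIV. (n i)\<^sup>2) = 2 * k" by linarith
    then have "even (\<Sum>i\<in>UNIV. n i)" using even_sum_squares[of n UNIV] by simp
    then show ?thesis using x unfolding D8_lattice_def by blast
  qed
  have s_half: "(\<Sum>i\<in>UNIV. (of_int (2 * n i + 1) / 2) *\<^sub>R f i) = (\<Sum>i\<in>UNIV. of_int (n i) *\<^sub>R f i) + s" for n
    by (simp add: s_def add_divide_distrib scaleR_add_left sum.distrib)
  have "E = D8_lattice f \<union> D8_glue f"
  proof (intro equalityI subsetI)
    fix x assume x: "x \<in> E"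
    show "x \<in> D8_lattice f \<union> D8_glue f"
    proof (cases "\<forall>i. x \<bullet> f i \<in> \<int>")
      case True
      then show ?thesis using D x by blast
    next
      case False
      then obtain k where k: "x \<bullet> f k \<notin> \<int>" by blast
      have half: "x \<bullet> f i - 1/2 \<in> \<int>" for i
      proof -
        have xsum: "x \<bullet> f i + x \<bullet> f j \<in> \<int>" for i j
          using sd(3)[OF x, of "f i + f j"] frame by (simp add: D8_frame_def inner_add_right)
        have "x \<bullet> f i \<notin> \<int>" using k xsum[of i k] by (metis Ints_diff add_diff_cancel_left')
        then show ?thesis using half_odd_of_double_Ints xsum[of i i] by simp
      qed
      have "x - s \<in> D8_lattice f"
      proof (rule D)
        show "x - s \<in> E" using x s by (intro add_subgroup_diff[OF grp]) (auto simp: s_def)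
        show "\<forall>i. (x - s) \<bullet> f i \<in> \<int>"
          using half by (simp add: inner_diff_left s_def D8_frame_inner_sum(1)[OF frame])
      qed
      then obtain n :: "8 \<Rightarrow> int" where n: "x - s = (\<Sum>i\<in>UNIV. of_int (n i) *\<^sub>R f i)" "even (\<Sum>i\<in>UNIV. n i)"
        unfolding D8_lattice_def by blast
      have "x = (\<Sum>i\<in>UNIV. (of_int (2 * n i + 1) / 2) *\<^sub>R f i)"
        using n(1) unfolding s_half by (metis diff_add_cancel)
      moreover obtain m where "(\<Sum>i\<in>UNIV. n i) = 2 * m" using n(2) by (rule evenE)
      then have "(\<Sum>i\<in>UNIV. 2 * n i + 1) = 4 * (m + 2)"
        by (simp add: sum.distrib flip: sum_distrib_left)
      then have "4 dvd (\<Sum>i\<in>UNIV. 2 * n i + 1)" by simp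
      ultimately have "x \<in> D8_glue f" unfolding D8_glue_def by (intro CollectI exI[of _ "\<lambda>i. 2 * n i + 1"]) auto
      then show ?thesis by simp
    qed
  next
    fix x assume "x \<in> D8_lattice f \<union> D8_glue f"
    then show "x \<in> E"
    proof
      assume "x \<in> D8_lattice f"
      then show ?thesis using D8_frame_even_sum_in[OF grp frame] unfolding D8_lattice_def by blast
    next
      assume "x \<in> D8_glue f"
      then obtain z where z: "x = (\<Sum>i\<in>UNIV. (of_int (z i) / 2) *\<^sub>R f i)" "\<And>i. odd (z i)"
        "4 dvd (\<Sum>i\<in>UNIV. z i)" unfolding D8_glue_def by blast
      have "\<forall>i. \<exists>n. z i = 2 * n + 1" using z(2) by (meson oddE)
      then obtain n where n: "\<And>i. z i = 2 * n i + 1" by metis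
      have "(\<Sum>i\<in>UNIV. z i) = 2 * (\<Sum>i\<in>UNIV. n i) + 8"
        by (simp add: n sum.distrib flip: sum_distrib_left)
      then have "even (\<Sum>i\<in>UNIV. n i)" using z(3) by presburger
      then have "(\<Sum>i\<in>UNIV. of_int (n i) *\<^sub>R f i) + s \<in> E"
        using s by (intro add_subgroup_add[OF grp] D8_frame_even_sum_in[OF grp frame]) (auto simp: s_def)
      then show ?thesis using s_half[of n] z(1) by (simp add: n)
    qed
  qed
  then show thesis using that frame by blast
qed

section \<open>Moments of the shells\<close>

text \<open>Multiplying out chooses one b per coordinate and adds the exponents. One coefficient of
  the product thus collects the moments over all tuples of a given norm.\<close>

lemma coeff_prod_sum_monom:
  fixes g :: "'i::finite \<Rightarrow> 'b \<Rightarrow> 'c::comm_semiring_1"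
  assumes "finite S"
  shows "coeff (\<Prod>i\<in>UNIV. \<Sum>b\<in>S. monom (g i b) (e b)) k =
    (\<Sum>z | (\<forall>i. z i \<in> S) \<and> (\<Sum>i\<in>UNIV. e (z i)) = k. \<Prod>i\<in>UNIV. g i (z i))"
proof -
  have monom: "(\<Prod>i\<in>I. monom (g i (z i)) (e (z i))) = monom (\<Prod>i\<in>I. g i (z i)) (\<Sum>i\<in>I. e (z i))"
    if "finite I" for I and z :: "'i \<Rightarrow> 'b"
    using that by (induction I) (simp_all add: mult_monom)
  have PiE: "PiE UNIV (\<lambda>_. S) = {z :: 'i \<Rightarrow> 'b. \<forall>i. z i \<in> S}" by (auto simp: PiE_def)
  then have fin: "finite {z :: 'i \<Rightarrow> 'b. \<forall>i. z i \<in> S}" using assms by (metis finite_PiE finite)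
  have "coeff (\<Prod>i\<in>UNIV. \<Sum>b\<in>S. monom (g i b) (e b)) k =
      (\<Sum>z | \<forall>i. z i \<in> S. if (\<Sum>i\<in>UNIV. e (z i)) = k then \<Prod>i\<in>UNIV. g i (z i) else 0)"
    using assms by (simp add: prod_sum_PiE PiE monom coeff_sum)
  also have "\<dots> = (\<Sum>z | (\<forall>i. z i \<in> S) \<and> (\<Sum>i\<in>UNIV. e (z i)) = k. \<Prod>i\<in>UNIV. g i (z i))"
    by (subst sum.inter_filter[OF fin, symmetric]) simp
  finally show ?thesis .
qed

definition int_shell :: "nat \<Rightarrow> (8 \<Rightarrow> int) set" where
  "int_shell m = {n. (\<Sum>i\<in>UNIV. (n i)\<^sup>2) = int m}"

text \<open>The entries are doubled coordinates, so norm m becomes 4 m.\<close>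

definition odd_shell :: "nat \<Rightarrow> (8 \<Rightarrow> int) set" where
  "odd_shell m = {z. (\<forall>i. odd (z i)) \<and> 4 dvd (\<Sum>i\<in>UNIV. z i) \<and> (\<Sum>i\<in>UNIV. (z i)\<^sup>2) = 4 * int m}"

text \<open>Generating functions of one coordinate: an integer coordinate \<open>b\<close> carries the exponent \<open>b\<^sup>2\<close>,
  an odd one the exponent \<open>(b\<^sup>2 - 1) / 8\<close>. In \<open>odd_twisted_gf\<close> each odd coordinate is weighted with the
  sign \<open>b \<equiv> \<plusminus> 1 (mod 4)\<close>, so that adding both odd series selects the sums divisible by \<open>4\<close>. The
  coordinates are cut off at the size that occurs in shells of norm at most \<open>8\<close>.\<close>

definition int_gf :: "nat \<Rightarrow> int poly" where
  "int_gf a = [:of_bool (a = 0), 1 + (- 1) ^ a, 0, 0, 2 ^ a + (- 2) ^ a:]"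

definition odd_gf :: "nat \<Rightarrow> int poly" where
  "odd_gf a = [:1 + (- 1) ^ a, 3 ^ a + (- 3) ^ a, 0, 5 ^ a + (- 5) ^ a:]"

definition odd_twisted_gf :: "nat \<Rightarrow> int poly" where
  "odd_twisted_gf a = [:1 - (- 1) ^ a, (- 3) ^ a - 3 ^ a, 0, 5 ^ a - (- 5) ^ a:]"

definition sign4 :: "int \<Rightarrow> int" where
  "sign4 b = (if b mod 4 = 1 then 1 else -1)"

lemma int_gf_eq: "int_gf a = (\<Sum>b\<in>{-2,-1,0,1,2}. monom (b ^ a) (nat (b\<^sup>2)))"
  by (simp add: int_gf_def monom_altdef numeral_eq_Suc of_bool_def power_0_left)

lemma odd_gf_eq: "odd_gf a = (\<Sum>b\<in>{-5,-3,-1,1,3,5}. monom (b ^ a) (nat ((b\<^sup>2 - 1) div 8)))"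
  by (simp add: odd_gf_def monom_altdef numeral_eq_Suc)

lemma odd_twisted_gf_eq:
  "odd_twisted_gf a = (\<Sum>b\<in>{-5,-3,-1,1,3,5}. monom (sign4 b * b ^ a) (nat ((b\<^sup>2 - 1) div 8)))"
  by (simp add: odd_twisted_gf_def monom_altdef numeral_eq_Suc sign4_def)

lemma coeff_prod_int_gf:
  assumes "m \<le> 8"
  shows "coeff (\<Prod>i\<in>UNIV. int_gf (\<alpha> i)) m = (\<Sum>n\<in>int_shell m. \<Prod>i\<in>UNIV. n i ^ \<alpha> i)"
proof -
  have "n \<in> int_shell m \<longleftrightarrow> (\<forall>i. n i \<in> {-2,-1,0,1,2}) \<and> (\<Sum>i\<in>UNIV. nat ((n i)\<^sup>2)) = m" for n
  proof -
    have "int (\<Sum>i\<in>UNIV. nat ((n i)\<^sup>2)) = (\<Sum>i\<in>UNIV. (n i)\<^sup>2)" by simp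
    then have "(\<Sum>i\<in>UNIV. nat ((n i)\<^sup>2)) = m \<longleftrightarrow> (\<Sum>i\<in>UNIV. (n i)\<^sup>2) = int m" by linarith
    moreover have "n i \<in> {-2,-1,0,1,2}" if "(\<Sum>i\<in>UNIV. (n i)\<^sup>2) = int m" for i
    proof -
      have "(n i)\<^sup>2 \<le> (\<Sum>i\<in>UNIV. (n i)\<^sup>2)" by (rule member_le_sum) auto
      then have "\<bar>n i\<bar>\<^sup>2 < 3\<^sup>2" using that assms by simp
      then have "\<bar>n i\<bar> < 3" by (rule power2_less_imp_less) simp
      then show ?thesis by auto
    qed
    ultimately show ?thesis by (auto simp: int_shell_def)
  qed
  then have "int_shell m = {n. (\<forall>i. n i \<in> {-2,-1,0,1,2}) \<and> (\<Sum>i\<in>UNIV. nat ((n i)\<^sup>2)) = m}" by blast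
  moreover have fin: "finite {-2,-1,0,1,2::int}" by simp
  ultimately show ?thesis unfolding int_gf_eq coeff_prod_sum_monom[OF fin] by simp
qed

text \<open>A factor changes the sign exactly when z i - 1 is 2 mod 4. The product therefore records
  the sum of the z i minus their number mod 4, and their number 8 is divisible by 4.\<close>

lemma prod_sign4:
  assumes "\<forall>i. odd (z i)"
  shows "(\<Prod>i\<in>UNIV. sign4 (z i)) = (if 4 dvd (\<Sum>i\<in>(UNIV::8 set). z i) then 1 else -1)"
proof -
  have *: "(\<Prod>i\<in>I. sign4 (z i)) = 1 \<and> ((\<Sum>i\<in>I. z i) - int (card I)) mod 4 = 0 \<or>
      (\<Prod>i\<in>I. sign4 (z i)) = -1 \<and> ((\<Sum>i\<in>I. z i) - int (card I)) mod 4 = 2" for I :: "8 set"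
  proof (induction I rule: infinite_finite_induct)
    case (insert j I)
    have "z j mod 4 = 1 \<or> z j mod 4 = 3" using assms[rule_format, of j] by presburger
    moreover have "(\<Sum>i\<in>insert j I. z i) - int (card (insert j I)) = ((\<Sum>i\<in>I. z i) - int (card I)) + z j - 1"
      using insert.hyps by simp
    moreover have "s mod 4 = a \<Longrightarrow> u mod 4 = 1 \<Longrightarrow> (s + u - 1) mod 4 = a"
      "s mod 4 = 0 \<Longrightarrow> u mod 4 = 3 \<Longrightarrow> (s + u - 1) mod 4 = 2"
      "s mod 4 = 2 \<Longrightarrow> u mod 4 = 3 \<Longrightarrow> (s + u - 1) mod 4 = 0" for s u a :: int by presburger+
    moreover have "(\<Prod>i\<in>insert j I. sign4 (z i)) = sign4 (z j) * (\<Prod>i\<in>I. sign4 (z i))"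
      using insert.hyps by simp
    ultimately show ?case using insert.IH by (elim disjE conjE) (simp_all add: sign4_def)
  qed auto
  have "(S - int (card (UNIV :: 8 set))) mod 4 = 0 \<Longrightarrow> 4 dvd S"
    "(S - int (card (UNIV :: 8 set))) mod 4 = 2 \<Longrightarrow> \<not> 4 dvd S" for S :: int
    by (simp_all, presburger+)
  then show ?thesis using *[of UNIV] by metis
qed

text \<open>Each odd square is 8 e + 1, so a sum of eight of them equals 4 m exactly when the e add
  up to m / 2 - 1; this is the coefficient index. The factor 2 comes from adding the trivial and the
  sign character.\<close>

lemma coeff_prod_odd_gf:
  assumes m: "m \<in> {2, 4, 6, 8}"
  shows "coeff (\<Prod>i\<in>UNIV. odd_gf (\<alpha> i)) (m div 2 - 1) + coeff (\<Prod>i\<in>UNIV. odd_twisted_gf (\<alpha> i)) (m div 2 - 1)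
    = 2 * (\<Sum>z\<in>odd_shell m. \<Prod>i\<in>UNIV. z i ^ \<alpha> i)"
proof -
  define S where "S = {-5,-3,-1,1,3,5::int}"
  define e where "e = (\<lambda>b::int. nat ((b\<^sup>2 - 1) div 8))"
  define Z where "Z = {z :: 8 \<Rightarrow> int. (\<forall>i. z i \<in> S) \<and> (\<Sum>i\<in>UNIV. e (z i)) = m div 2 - 1}"
  have finS: "finite S" by (simp add: S_def)
  have finZ: "finite Z"
  proof (rule finite_subset)
    show "Z \<subseteq> PiE UNIV (\<lambda>_. S)" by (auto simp: Z_def)
    show "finite (PiE (UNIV :: 8 set) (\<lambda>_. S))" using finS by (intro finite_PiE) auto
  qed
  have odd: "odd (z i)" if "z \<in> Z" for z i
    using that by (auto simp: Z_def S_def dest!: spec[of _ i])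
  have *: "z \<in> Z \<longleftrightarrow> (\<forall>i. odd (z i)) \<and> (\<Sum>i\<in>UNIV. (z i)\<^sup>2) = 4 * int m" for z
  proof -
    have e: "(z i)\<^sup>2 = 8 * int (e (z i)) + 1" if odd_i: "odd (z i)" for i
    proof -
      obtain j where j: "z i = 2 * j + 1" using odd_i by (rule oddE)
      have "even (j * (j + 1))" by simp
      then obtain l where l: "j * (j + 1) = 2 * l" by (rule evenE)
      have sq: "(z i)\<^sup>2 = 8 * l + 1" using l by (simp add: j power2_eq_square algebra_simps)
      moreover have "0 \<le> (z i)\<^sup>2" by simp
      ultimately show ?thesis by (simp add: e_def)
    qed
    have sum: "(\<Sum>i\<in>UNIV. (z i)\<^sup>2) = 8 * int (\<Sum>i\<in>UNIV. e (z i)) + 8" if "\<forall>i. odd (z i)"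
      using that by (simp add: e sum.distrib flip: sum_distrib_left)
    have S: "z i \<in> S" if "\<forall>i. odd (z i)" "(\<Sum>i\<in>UNIV. (z i)\<^sup>2) = 4 * int m" for i
    proof -
      have "(z i)\<^sup>2 \<le> (\<Sum>i\<in>UNIV. (z i)\<^sup>2)" by (rule member_le_sum) auto
      then have "\<bar>z i\<bar>\<^sup>2 < 6\<^sup>2" using that m by auto
      then have "\<bar>z i\<bar> < 6" by (rule power2_less_imp_less) simp
      then have "z i \<in> {-5..5}" by auto
      also have "{-5..5} = {-5,-4,-3,-2,-1,0,1,2,3,4,5::int}" by (simp add: set_eq_iff) presburger
      finally show ?thesis using that(1)[rule_format, of i] by (auto simp: S_def)
    qed
    have m2: "8 * int s + 8 = 4 * int m \<longleftrightarrow> s = m div 2 - 1" for s using m by auto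
    show ?thesis
    proof
      assume z: "z \<in> Z"
      then have o: "\<forall>i. odd (z i)" using odd by blast
      have "(\<Sum>i\<in>UNIV. e (z i)) = m div 2 - 1" using z unfolding Z_def by blast
      then have "(\<Sum>i\<in>UNIV. (z i)\<^sup>2) = 4 * int m" by (rule trans[OF sum[OF o] iffD2[OF m2]])
      with o show "(\<forall>i. odd (z i)) \<and> (\<Sum>i\<in>UNIV. (z i)\<^sup>2) = 4 * int m" by blast
    next
      assume z: "(\<forall>i. odd (z i)) \<and> (\<Sum>i\<in>UNIV. (z i)\<^sup>2) = 4 * int m"
      then have o: "\<forall>i. odd (z i)" and n: "(\<Sum>i\<in>UNIV. (z i)\<^sup>2) = 4 * int m" by blast+
      have "(\<Sum>i\<in>UNIV. e (z i)) = m div 2 - 1"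
        by (rule iffD1[OF m2]) (rule trans[OF sum[OF o, symmetric] n])
      then show "z \<in> Z" using S[OF o n] unfolding Z_def by blast
    qed
  qed
  have shell: "odd_shell m = {z\<in>Z. 4 dvd (\<Sum>i\<in>UNIV. z i)}"
    by (auto simp: odd_shell_def *)
  have "coeff (\<Prod>i\<in>UNIV. odd_gf (\<alpha> i)) (m div 2 - 1) = (\<Sum>z\<in>Z. \<Prod>i\<in>UNIV. z i ^ \<alpha> i)"
    unfolding odd_gf_eq coeff_prod_sum_monom[OF finS[unfolded S_def]]
    by (simp only: Z_def S_def e_def)
  moreover have "coeff (\<Prod>i\<in>UNIV. odd_twisted_gf (\<alpha> i)) (m div 2 - 1)
      = (\<Sum>z\<in>Z. \<Prod>i\<in>UNIV. sign4 (z i) * z i ^ \<alpha> i)"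
    unfolding odd_twisted_gf_eq coeff_prod_sum_monom[OF finS[unfolded S_def]]
    by (simp only: Z_def S_def e_def)
  moreover have "(\<Sum>z\<in>Z. \<Prod>i\<in>UNIV. sign4 (z i) * z i ^ \<alpha> i)
      = (\<Sum>z\<in>Z. (if 4 dvd (\<Sum>i\<in>UNIV. z i) then 1 else -1) * (\<Prod>i\<in>UNIV. z i ^ \<alpha> i))"
    using odd by (intro sum.cong) (auto simp: prod.distrib prod_sign4)
  moreover have "(\<Sum>z\<in>Z. \<Prod>i\<in>UNIV. z i ^ \<alpha> i) + (\<Sum>z\<in>Z. (if 4 dvd (\<Sum>i\<in>UNIV. z i) then 1 else -1) * (\<Prod>i\<in>UNIV. z i ^ \<alpha> i))
      = (\<Sum>z\<in>Z. if 4 dvd (\<Sum>i\<in>UNIV. z i) then 2 * (\<Prod>i\<in>UNIV. z i ^ \<alpha> i) else 0)"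
    unfolding sum.distrib[symmetric] by (intro sum.cong) auto
  moreover have "\<dots> = 2 * (\<Sum>z\<in>odd_shell m. \<Prod>i\<in>UNIV. z i ^ \<alpha> i)"
    unfolding shell sum_distrib_left using finZ by (simp add: sum.inter_filter)
  ultimately show ?thesis by simp
qed

lemma finite_int_shell: "finite (int_shell m)"
proof (rule finite_subset)
  show "int_shell m \<subseteq> PiE UNIV (\<lambda>_. {- int m..int m})"
  proof
    fix n assume n: "n \<in> int_shell m"
    have "\<bar>n i\<bar> \<le> int m" for i
    proof -
      have "\<bar>n i\<bar> \<le> (n i)\<^sup>2"
      proof (cases "n i = 0")
        case False
        then have "1 * \<bar>n i\<bar> \<le> \<bar>n i\<bar> * \<bar>n i\<bar>" by (intro mult_right_mono) auto
        then show ?thesis by (simp add: power2_eq_square abs_mult_self_eq)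
      qed simp
      also have "\<dots> \<le> (\<Sum>i\<in>UNIV. (n i)\<^sup>2)" by (rule member_le_sum) auto
      finally show ?thesis using n by (simp add: int_shell_def)
    qed
    then show "n \<in> PiE UNIV (\<lambda>_. {- int m..int m})" by (auto simp: abs_le_iff minus_le_iff)
  qed
  show "finite (PiE (UNIV :: 8 set) (\<lambda>_. {- int m..int m}))" by (intro finite_PiE) auto
qed

lemma finite_odd_shell: "finite (odd_shell m)"
  by (rule finite_subset[OF _ finite_int_shell[of "4 * m"]]) (auto simp: odd_shell_def int_shell_def)

text \<open>On the integral part the condition of even coordinate sum is automatic for even m, since
  a square has the parity of its root. The two parts are disjoint because only one of them has
  integral coordinates.\<close>

lemma sum_shell:
  fixes f :: "8 \<Rightarrow> real ^ 8" and g :: "real ^ 8 \<Rightarrow> 'b::comm_monoid_add"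
  assumes f: "D8_frame E f" and E: "E = D8_lattice f \<union> D8_glue f" and m: "even m"
  shows "finite (shell E (real m))"
    and "(\<Sum>x\<in>shell E (real m). g x) = (\<Sum>n\<in>int_shell m. g (\<Sum>i\<in>UNIV. of_int (n i) *\<^sub>R f i))
      + (\<Sum>z\<in>odd_shell m. g (\<Sum>i\<in>UNIV. (of_int (z i) / 2) *\<^sub>R f i))"
proof -
  define p where "p = (\<lambda>n :: 8 \<Rightarrow> int. \<Sum>i\<in>UNIV. of_int (n i) *\<^sub>R f i)"
  define q where "q = (\<lambda>z :: 8 \<Rightarrow> int. \<Sum>i\<in>UNIV. (of_int (z i) / 2) *\<^sub>R f i)"
  have pf: "p n \<bullet> f j = of_int (n j)" "q n \<bullet> f j = of_int (n j) / 2" for n j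
    by (simp_all only: p_def q_def D8_frame_inner_sum(1)[OF f])
  have "inj p"
  proof (rule injI, rule ext)
    fix n n' i assume "p n = p n'"
    then have "p n \<bullet> f i = p n' \<bullet> f i" by simp
    then show "n i = n' i" by (simp only: pf of_int_eq_iff)
  qed
  moreover have "inj q"
  proof (rule injI, rule ext)
    fix n n' i assume "q n = q n'"
    then have "q n \<bullet> f i = q n' \<bullet> f i" by simp
    then show "n i = n' i" by (simp add: pf)
  qed
  ultimately have inj: "inj_on p A" "inj_on q A" for A by (auto intro: inj_on_subset)
  have p_nrm: "p n \<bullet> p n = real m \<longleftrightarrow> n \<in> int_shell m" for n
  proof -
    have "p n \<bullet> p n = of_int (\<Sum>i\<in>UNIV. (n i)\<^sup>2)"
      by (simp add: p_def D8_frame_inner_sum(2)[OF f] power2_eq_square)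
    then have "p n \<bullet> p n = real m \<longleftrightarrow> real_of_int (\<Sum>i\<in>UNIV. (n i)\<^sup>2) = of_int (int m)" by simp
    then show ?thesis unfolding int_shell_def of_int_eq_iff by simp
  qed
  have q_nrm: "q z \<bullet> q z = real m \<longleftrightarrow> (\<Sum>i\<in>UNIV. (z i)\<^sup>2) = 4 * int m" for z
  proof -
    have "q z \<bullet> q z = of_int (\<Sum>i\<in>UNIV. (z i)\<^sup>2) / 4"
      by (simp add: q_def D8_frame_inner_sum(2)[OF f] power2_eq_square sum_divide_distrib)
    then have "q z \<bullet> q z = real m \<longleftrightarrow> real_of_int (\<Sum>i\<in>UNIV. (z i)\<^sup>2) = of_int (4 * int m)" by auto
    then show ?thesis by (simp only: of_int_eq_iff)
  qed
  have ev: "even (\<Sum>i\<in>UNIV. n i)" if "n \<in> int_shell m" for n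
    using that m even_sum_squares[of n UNIV] by (simp add: int_shell_def)
  have lat: "D8_lattice f = {p n | n. even (\<Sum>i\<in>UNIV. n i)}"
    and glue: "D8_glue f = {q z | z. (\<forall>i. odd (z i)) \<and> 4 dvd (\<Sum>i\<in>UNIV. z i)}"
    by (simp_all only: p_def q_def D8_lattice_def D8_glue_def)
  have shell: "shell E (real m) = p ` int_shell m \<union> q ` odd_shell m"
    unfolding shell_def E lat glue odd_shell_def using p_nrm q_nrm ev by blast
  have disj: "p ` int_shell m \<inter> q ` odd_shell m = {}"
  proof -
    have "p n \<noteq> q z" if "z \<in> odd_shell m" for n z
    proof
      assume "p n = q z"
      then have "real_of_int (n 0) = of_int (z 0) / 2" by (metis pf)
      then have "real_of_int (z 0) = of_int (2 * n 0)" by simp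
      then have "z 0 = 2 * n 0" by (simp only: of_int_eq_iff)
      then show False using that by (auto simp: odd_shell_def dest!: spec[of _ 0])
    qed
    then show ?thesis by blast
  qed
  show "finite (shell E (real m))" unfolding shell using finite_int_shell finite_odd_shell by blast
  have "(\<Sum>x\<in>shell E (real m). g x) = (\<Sum>n\<in>int_shell m. g (p n)) + (\<Sum>z\<in>odd_shell m. g (q z))"
    unfolding shell using disj finite_int_shell finite_odd_shell
    by (subst sum.union_disjoint) (simp_all add: sum.reindex[OF inj(1)] sum.reindex[OF inj(2)])
  then show "(\<Sum>x\<in>shell E (real m). g x) = (\<Sum>n\<in>int_shell m. g (\<Sum>i\<in>UNIV. of_int (n i) *\<^sub>R f i))
      + (\<Sum>z\<in>odd_shell m. g (\<Sum>i\<in>UNIV. (of_int (z i) / 2) *\<^sub>R f i))"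
    by (simp only: p_def q_def)
qed

text \<open>\<open>gauss_moment a\<close> is the \<open>a\<close>-th moment of the standard normal distribution.\<close>

fun gauss_moment :: "nat \<Rightarrow> int" where
  "gauss_moment 0 = 1"
| "gauss_moment (Suc 0) = 0"
| "gauss_moment (Suc (Suc n)) = int (Suc n) * gauss_moment n"

text \<open>These are the Taylor coefficients of exp (x^2 / 2), the moment generating function of
  the normal distribution.\<close>

lemma gauss_moment_over_fact:
  "real_of_int (gauss_moment a) / fact a = (if even a then 1 / (2 ^ (a div 2) * fact (a div 2)) else 0)"
proof (induction a rule: gauss_moment.induct)
  case (3 n)
  have "real_of_int (gauss_moment (Suc (Suc n))) / fact (Suc (Suc n))
      = (real n + 1) * real_of_int (gauss_moment n) / ((real n + 1) * (fact n * (real n + 2)))"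
    by (simp add: algebra_simps)
  also have "\<dots> = real_of_int (gauss_moment n) / fact n / (real n + 2)"
    by (subst mult_divide_mult_cancel_left) auto
  also have "\<dots> = (if even n then 1 / (2 ^ (n div 2) * fact (n div 2)) else 0) / (real n + 2)"
    by (simp only: 3)
  also have "\<dots> = (if even (Suc (Suc n)) then 1 / (2 ^ (Suc (Suc n) div 2) * fact (Suc (Suc n) div 2)) else 0)"
  proof (cases "even n")
    case True
    then obtain b where "n = 2 * b" by (rule evenE)
    then show ?thesis by (simp add: algebra_simps)
  qed simp
  finally show ?case .
qed simp_all

section \<open>Multinomial and Gaussian expansions\<close>

lemma prod_fps_exp: "(\<Prod>i\<in>I. fps_exp (c i :: 'a::field_char_0)) = fps_exp (\<Sum>i\<in>I. c i)"
  by (induction I rule: infinite_finite_induct) (simp_all add: fps_exp_add_mult)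

text \<open>This is the multinomial theorem, read off from a product of exponential series.
  Multisets serve as exponent vectors of total degree k.\<close>

lemma power_sum_multinomial:
  fixes x y :: "'i::finite \<Rightarrow> real"
  shows "(\<Sum>i\<in>UNIV. x i * y i) ^ k = (\<Sum>X\<in>multisets_of_size UNIV k.
    fact k * (\<Prod>i\<in>UNIV. y i ^ count X i / fact (count X i)) * (\<Prod>i\<in>UNIV. x i ^ count X i))"
proof -
  have "(\<Sum>i\<in>UNIV. x i * y i) ^ k / fact k = fps_nth (\<Prod>i\<in>UNIV. fps_exp (x i * y i)) k"
    by (simp add: prod_fps_exp)
  also have "\<dots> = (\<Sum>X\<in>multisets_of_size UNIV k. (\<Prod>i\<in>UNIV. (x i * y i) ^ count X i / fact (count X i)))"
    by (simp add: fps_prod_nth')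
  finally have "(\<Sum>i\<in>UNIV. x i * y i) ^ k
      = fact k * (\<Sum>X\<in>multisets_of_size UNIV k. (\<Prod>i\<in>UNIV. (x i * y i) ^ count X i / fact (count X i)))"
    by (simp add: field_simps)
  then show ?thesis
    by (simp add: sum_distrib_left power_mult_distrib prod.distrib prod_dividef mult_ac)
qed

text \<open>The product of the series exp (y i^2 q^2 / 2) is exp (|y|^2 q^2 / 2), so Gaussian
  moments assemble to a power of |y|^2. Proportionality to them is what the shells have to
  satisfy.\<close>

lemma sum_gauss_moments:
  fixes y :: "'i::finite \<Rightarrow> real"
  shows "(\<Sum>X\<in>multisets_of_size UNIV (2 * h). (\<Prod>i\<in>UNIV. y i ^ count X i / fact (count X i))
      * (\<Prod>i\<in>UNIV. of_int (gauss_moment (count X i)))) = (\<Sum>i\<in>UNIV. (y i)\<^sup>2) ^ h / (2 ^ h * fact h)"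
proof -
  have nth: "fps_nth (fps_exp ((y i)\<^sup>2 / 2) oo fps_X ^ 2) a = y i ^ a / fact a * of_int (gauss_moment a)" for i a
  proof -
    have "y i ^ a / fact a * of_int (gauss_moment a) = y i ^ a * (of_int (gauss_moment a) / fact a)" by simp
    also have "\<dots> = (if even a then y i ^ a / (2 ^ (a div 2) * fact (a div 2)) else 0)"
      by (simp only: gauss_moment_over_fact) simp
    finally show ?thesis
      by (auto simp: fps_nth_compose_X_power power_divide elim!: evenE simp flip: power_mult)
  qed
  have comp: "(\<Prod>i\<in>I. fps_exp (c i) oo fps_X ^ 2) = fps_exp (\<Sum>i\<in>I. c i) oo fps_X ^ 2" for I and c :: "'i \<Rightarrow> real"
    by (induction I rule: infinite_finite_induct)
       (simp_all add: fps_exp_add_mult fps_compose_mult_distrib)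
  have "(\<Sum>X\<in>multisets_of_size UNIV (2 * h). (\<Prod>i\<in>UNIV. y i ^ count X i / fact (count X i))
      * (\<Prod>i\<in>UNIV. of_int (gauss_moment (count X i)))) = fps_nth (\<Prod>i\<in>UNIV. fps_exp ((y i)\<^sup>2 / 2) oo fps_X ^ 2) (2 * h)"
    by (simp add: fps_prod_nth' nth flip: prod.distrib)
  also have "\<dots> = (\<Sum>i\<in>UNIV. (y i)\<^sup>2) ^ h / (2 ^ h * fact h)"
    by (simp add: comp fps_nth_compose_X_power power_divide flip: sum_divide_distrib)
  finally show ?thesis .
qed

text \<open>Truncated multiplication by \<open>a + b q + c q\<^sup>4\<close> and by \<open>a + b q + c q\<^sup>3\<close> on coefficient lists.\<close>

fun conv9 :: "int \<Rightarrow> int \<Rightarrow> int \<Rightarrow> int list \<Rightarrow> int list" where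
  "conv9 a b c [t0,t1,t2,t3,t4,t5,t6,t7,t8] =
    [a*t0, a*t1 + b*t0, a*t2 + b*t1, a*t3 + b*t2, a*t4 + b*t3 + c*t0,
     a*t5 + b*t4 + c*t1, a*t6 + b*t5 + c*t2, a*t7 + b*t6 + c*t3, a*t8 + b*t7 + c*t4]"
| "conv9 a b c _ = []"

fun conv4 :: "int \<Rightarrow> int \<Rightarrow> int \<Rightarrow> int list \<Rightarrow> int list" where
  "conv4 a b c [t0,t1,t2,t3] = [a*t0, a*t1 + b*t0, a*t2 + b*t1, a*t3 + b*t2 + c*t0]"
| "conv4 a b c _ = []"

section \<open>A computable test over exponent multisets\<close>

type_synonym gf_state = "int list \<times> int list \<times> int list"

definition coeffs_below :: "nat \<Rightarrow> int poly \<Rightarrow> int list" where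
  "coeffs_below k p = map (coeff p) [0..<k]"

text \<open>Norms up to 8 need the coefficients 0 to 8 of the integral series, but only 0 to 8 / 2 -
  1 = 3 of the odd ones.\<close>

definition gf_state :: "nat list \<Rightarrow> gf_state" where
  "gf_state as = (coeffs_below 9 (prod_list (map int_gf as)), coeffs_below 4 (prod_list (map odd_gf as)),
    coeffs_below 4 (prod_list (map odd_twisted_gf as)))"

text \<open>Contributions of b and -b cancel in the twisted series for even a and in the other two
  for odd a, so each parity leaves only one kind of series alive.\<close>

definition gf_step :: "nat \<Rightarrow> gf_state \<Rightarrow> gf_state" where
  "gf_step a = (\<lambda>(T, U, V).
    if even a then (conv9 (if a = 0 then 1 else 0) 2 (2 * 2 ^ a) T, conv4 2 (2 * 3 ^ a) (2 * 5 ^ a) U, [0,0,0,0])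
    else ([0,0,0,0,0,0,0,0,0], [0,0,0,0], conv4 2 (- 2 * 3 ^ a) (2 * 5 ^ a) V))"

lemma gf_step_state: "gf_step a (gf_state as) = gf_state (a # as)"
proof -
  have 9: "[0..<9] = [0,1,2,3,4,5,6,7,8]" and 4: "[0..<4] = [0,1,2,3]"
    by (simp_all add: upt_rec)
  have "a \<noteq> 0" if "odd a" using that by (rule contrapos_nn) simp
  then show ?thesis
    by (cases "even a")
       (simp_all add: gf_step_def gf_state_def coeffs_below_def 9 4 int_gf_def odd_gf_def odd_twisted_gf_def
         coeff_pCons algebra_simps split: nat.split)
qed

text \<open>The check runs over all nonincreasing lists of length \<open>k\<close> with sum \<open>n\<close> and entries at most \<open>b\<close>,
  sharing the work on common prefixes.\<close>

fun gf_check :: "(gf_state \<Rightarrow> int \<Rightarrow> bool) \<Rightarrow> nat \<Rightarrow> nat \<Rightarrow> nat \<Rightarrow> gf_state \<Rightarrow> int \<Rightarrow> bool" where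
  "gf_check P 0 n b S d = (n = 0 \<longrightarrow> P S d)"
| "gf_check P (Suc k) n b S d =
    list_all (\<lambda>a. gf_check P k (n - a) a (gf_step a S) (d * gauss_moment a)) [0..<Suc (min n b)]"

text \<open>Each step prepends the exponent just chosen, hence the reversal; \<open>d\<close>
  accumulates the Gaussian moments of the prefix.\<close>

lemma gf_check_sound:
  assumes "gf_check P k n b (gf_state bs) d"
    and "length as = k" "sum_list as = n" "sorted_wrt (\<ge>) as" "\<forall>a\<in>set as. a \<le> b"
  shows "P (gf_state (rev as @ bs)) (d * prod_list (map gauss_moment as))"
  using assms
proof (induction as arbitrary: k n b bs d)
  case (Cons a as)
  obtain k' where k: "k = Suc k'" "length as = k'" using Cons.prems(2) by auto
  have "a \<in> set [0..<Suc (min n b)]" using Cons.prems(3,5) by auto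
  then have "gf_check P k' (n - a) a (gf_step a (gf_state bs)) (d * gauss_moment a)"
    using Cons.prems(1) unfolding k(1) gf_check.simps list_all_iff by blast
  then have "P (gf_state (rev as @ a # bs)) (d * gauss_moment a * prod_list (map gauss_moment as))"
    unfolding gf_step_state using Cons.prems k by (intro Cons.IH) auto
  then show ?case by (simp add: mult.assoc)
qed simp

text \<open>This is twice the moment in doubled coordinates: integral vectors acquire the factor
  2^t, and U + V already counts the odd vectors twice.\<close>

definition gf_moment :: "nat \<Rightarrow> gf_state \<Rightarrow> nat \<Rightarrow> int" where
  "gf_moment t = (\<lambda>(T, U, V) m. 2 * 2 ^ t * T ! m + U ! (m div 2 - 1) + V ! (m div 2 - 1))"

definition shell_moment :: "nat \<Rightarrow> nat \<Rightarrow> (8 \<Rightarrow> nat) \<Rightarrow> int" where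
  "shell_moment t m \<alpha> = 2 ^ t * (\<Sum>n\<in>int_shell m. \<Prod>i\<in>UNIV. n i ^ \<alpha> i)
    + (\<Sum>z\<in>odd_shell m. \<Prod>i\<in>UNIV. z i ^ \<alpha> i)"

lemma prod_list_map_UNIV:
  fixes g :: "nat \<Rightarrow> 'b::comm_monoid_mult"
  assumes "mset as = image_mset \<alpha> (mset_set (UNIV :: 'i::finite set))"
  shows "prod_list (map g as) = (\<Prod>i\<in>UNIV. g (\<alpha> i))"
proof -
  have "prod_list (map g as) = prod_mset (image_mset g (mset as))" by (simp flip: prod_mset_prod_list)
  also have "\<dots> = (\<Prod>i\<in>UNIV. g (\<alpha> i))"
    unfolding assms by (simp add: multiset.map_comp prod_unfold_prod_mset comp_def)
  finally show ?thesis .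
qed

lemma gf_moment_eq:
  assumes as: "mset as = image_mset \<alpha> (mset_set (UNIV :: 8 set))" and m: "m \<in> {2, 4, 6, 8}"
  shows "gf_moment t (gf_state as) m = 2 * shell_moment t m \<alpha>"
proof -
  have "m < 9" "m \<le> 8" "m div 2 - 1 < 4" using m by auto
  then have "gf_moment t (gf_state as) m = 2 * 2 ^ t * coeff (\<Prod>i\<in>UNIV. int_gf (\<alpha> i)) m
      + (coeff (\<Prod>i\<in>UNIV. odd_gf (\<alpha> i)) (m div 2 - 1) + coeff (\<Prod>i\<in>UNIV. odd_twisted_gf (\<alpha> i)) (m div 2 - 1))"
    by (simp add: gf_moment_def gf_state_def coeffs_below_def prod_list_map_UNIV[OF as] del: upt_Suc)
  then show ?thesis
    unfolding coeff_prod_odd_gf[OF m] coeff_prod_int_gf[OF \<open>m \<le> 8\<close>] by (simp add: shell_moment_def)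
qed

definition design_check :: "nat \<Rightarrow> (int \<times> nat) list \<Rightarrow> int \<Rightarrow> bool" where
  "design_check t us C = gf_check
    (\<lambda>S d. (\<Sum>(u, m)\<leftarrow>us. u * gf_moment t S m) = 2 * C * d) 8 t t (gf_state []) 1"

lemma gf_state_Nil: "gf_state [] = ([1,0,0,0,0,0,0,0,0], [1,0,0,0], [1,0,0,0])"
proof -
  have 9: "[0..<9] = [0,1,2,3,4,5,6,7,8]" and 4: "[0..<4] = [0,1,2,3]"
    by (simp_all add: upt_rec)
  show ?thesis by (simp add: gf_state_def coeffs_below_def 9 4)
qed

text \<open>The moments on both sides depend only on the multiset of exponents, so the exponents may
  be sorted into a list that the test visits.\<close>

lemma design_check_sound:
  assumes "design_check t us C" and us: "snd ` set us \<subseteq> {2, 4, 6, 8}" and \<alpha>: "(\<Sum>i\<in>UNIV. \<alpha> i) = t"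
  shows "(\<Sum>(u, m)\<leftarrow>us. u * shell_moment t m \<alpha>) = C * (\<Prod>i\<in>UNIV. gauss_moment (\<alpha> i))"
proof -
  define as where "as = rev (sorted_list_of_multiset (image_mset \<alpha> (mset_set (UNIV :: 8 set))))"
  have as: "mset as = image_mset \<alpha> (mset_set (UNIV :: 8 set))" by (simp add: as_def)
  have len: "length as = 8" using arg_cong[OF as, of size] by simp
  have sum: "sum_list as = t"
    using arg_cong[OF as, of sum_mset] \<alpha> by (simp add: sum_unfold_sum_mset sum_mset_sum_list)
  have sorted: "sorted_wrt (\<ge>) as"
    by (simp add: as_def sorted_wrt_rev sorted_sorted_list_of_multiset)
  have le: "\<forall>a\<in>set as. a \<le> t" using sum member_le_sum_list by blast
  have "(\<Sum>(u, m)\<leftarrow>us. u * gf_moment t (gf_state (rev as)) m) = 2 * C * prod_list (map gauss_moment as)"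
    using gf_check_sound[OF assms(1)[unfolded design_check_def] len sum sorted le] by simp
  moreover have "gf_moment t (gf_state (rev as)) m = 2 * shell_moment t m \<alpha>" if "(u, m) \<in> set us" for u m
    using us that by (intro gf_moment_eq) (auto simp: as)
  then have "(\<Sum>(u, m)\<leftarrow>us. u * gf_moment t (gf_state (rev as)) m)
      = (\<Sum>(u, m)\<leftarrow>us. 2 * (u * shell_moment t m \<alpha>))"
    by (intro arg_cong[of _ _ sum_list] map_cong) auto
  moreover have "\<dots> = 2 * (\<Sum>(u, m)\<leftarrow>us. u * shell_moment t m \<alpha>)"
    by (induction us) auto
  ultimately show ?thesis by (simp add: prod_list_map_UNIV[OF as])
qed

lemma card_shell:
  fixes f :: "8 \<Rightarrow> real ^ 8"
  assumes f: "D8_frame E f" and E: "E = D8_lattice f \<union> D8_glue f" and m: "m \<in> {2, 4, 6, 8}"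
  shows "2 * int (card (shell E (real m))) = gf_moment 0 (gf_state [0,0,0,0,0,0,0,0]) m"
proof -
  have "mset [0,0,0,0,0,0,0,0] = image_mset (\<lambda>_. 0) (mset_set (UNIV :: 8 set))"
    by (simp add: image_mset_const_eq numeral_eq_Suc)
  then have "gf_moment 0 (gf_state [0,0,0,0,0,0,0,0]) m = 2 * shell_moment 0 m (\<lambda>_. 0)"
    by (rule gf_moment_eq[OF _ m])
  moreover have "even m" using m by auto
  then have "real (card (shell E (real m))) = real (card (int_shell m)) + real (card (odd_shell m))"
    using sum_shell(2)[OF f E, of m "\<lambda>_. 1 :: real"] by simp
  ultimately show ?thesis by (simp add: shell_moment_def flip: of_nat_add)
qed

lemma card_shell_values:
  fixes f :: "8 \<Rightarrow> real ^ 8"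
  assumes f: "D8_frame E f" and E: "E = D8_lattice f \<union> D8_glue f"
  shows "card (shell E 2) = 240" "card (shell E 4) = 2160" "card (shell E 6) = 6720" "card (shell E 8) = 17520"
proof -
  \<comment> \<open>The first list counts representations of 0, ..., 8 as sums of eight squares. The
    twisted list vanishes, so exactly half of the odd vectors have sum divisible by 4.\<close>
  have gf: "gf_state [0,0,0,0,0,0,0,0] = ([1,16,112,448,1136,2016,3136,5504,9328],[256,2048,7168,16384],[0,0,0,0])"
    by (simp add: gf_state_Nil gf_step_def flip: gf_step_state)
  show "card (shell E 2) = 240" "card (shell E 4) = 2160" "card (shell E 6) = 6720" "card (shell E 8) = 17520"
    using card_shell[OF f E, of 2] card_shell[OF f E, of 4] card_shell[OF f E, of 6] card_shell[OF f E, of 8]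
    by (simp_all add: gf gf_moment_def)
qed

lemma shell_power_sum:
  fixes f :: "8 \<Rightarrow> real ^ 8"
  assumes f: "D8_frame E f" and E: "E = D8_lattice f \<union> D8_glue f" and m: "even m"
  shows "2 ^ t * (\<Sum>x\<in>shell E (real m). (x \<bullet> y) ^ t) = (\<Sum>X\<in>multisets_of_size UNIV t.
    fact t * (\<Prod>i\<in>UNIV. (f i \<bullet> y) ^ count X i / fact (count X i)) * of_int (shell_moment t m (count X)))"
proof -
  define K where "K = (\<lambda>X. fact t * (\<Prod>i\<in>UNIV. (f i \<bullet> y) ^ count X i / fact (count X i)))"
  define a where "a = (\<lambda>X. \<Sum>n\<in>int_shell m. \<Prod>i\<in>UNIV. n i ^ count X i)"
  define b where "b = (\<lambda>X. \<Sum>z\<in>odd_shell m. \<Prod>i\<in>UNIV. z i ^ count X i)"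
  have "2 ^ t * (\<Sum>x\<in>shell E (real m). (x \<bullet> y) ^ t) =
      2 ^ t * (\<Sum>n\<in>int_shell m. (\<Sum>i\<in>UNIV. of_int (n i) * (f i \<bullet> y)) ^ t)
      + (\<Sum>z\<in>odd_shell m. (\<Sum>i\<in>UNIV. of_int (z i) * (f i \<bullet> y)) ^ t)"
    unfolding sum_shell(2)[OF f E m]
    by (simp add: inner_sum_left distrib_left power_divide flip: sum_divide_distrib)
  also have "(\<Sum>n\<in>int_shell m. (\<Sum>i\<in>UNIV. of_int (n i) * (f i \<bullet> y)) ^ t)
      = (\<Sum>X\<in>multisets_of_size UNIV t. K X * of_int (a X))"
    unfolding power_sum_multinomial a_def K_def by (subst sum.swap) (simp add: sum_distrib_left)
  also have "(\<Sum>z\<in>odd_shell m. (\<Sum>i\<in>UNIV. of_int (z i) * (f i \<bullet> y)) ^ t)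
      = (\<Sum>X\<in>multisets_of_size UNIV t. K X * of_int (b X))"
    unfolding power_sum_multinomial b_def K_def by (subst sum.swap) (simp add: sum_distrib_left)
  also have "2 ^ t * (\<Sum>X\<in>multisets_of_size UNIV t. K X * of_int (a X))
      + (\<Sum>X\<in>multisets_of_size UNIV t. K X * of_int (b X))
      = (\<Sum>X\<in>multisets_of_size UNIV t. K X * of_int (2 ^ t * a X + b X))"
    by (simp add: sum_distrib_left distrib_left sum.distrib mult_ac)
  finally show ?thesis unfolding K_def a_def b_def shell_moment_def .
qed

text \<open>In the constant, 2^(2h) undoes the doubling of coordinates and (2h)! / (2^h h!) is the
  Gaussian moment of order 2h.\<close>

lemma design_identity:
  fixes f :: "8 \<Rightarrow> real ^ 8"
  assumes f: "D8_frame E f" and E: "E = D8_lattice f \<union> D8_glue f"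
    and chk: "design_check (2 * h) us C" and us: "snd ` set us \<subseteq> {2, 4, 6, 8}"
  shows "(\<Sum>(u, m)\<leftarrow>us. of_int u * (\<Sum>x\<in>shell E (real m). (x \<bullet> y) ^ (2 * h)))
    = (C * fact (2 * h) / (2 ^ (2 * h) * (2 ^ h * fact h))) * (y \<bullet> y) ^ h"
proof -
  define K where "K = (\<lambda>X. fact (2 * h) * (\<Prod>i\<in>UNIV. (f i \<bullet> y) ^ count X i / fact (count X i)))"
  have "2 ^ (2 * h) * (\<Sum>(u, m)\<leftarrow>us. of_int u * (\<Sum>x\<in>shell E (real m). (x \<bullet> y) ^ (2 * h)))
      = (\<Sum>(u, m)\<leftarrow>us. of_int u * (2 ^ (2 * h) * (\<Sum>x\<in>shell E (real m). (x \<bullet> y) ^ (2 * h))))"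
    by (induction us) (auto simp: algebra_simps)
  also have "\<dots> = (\<Sum>(u, m)\<leftarrow>us. of_int u * (\<Sum>X\<in>multisets_of_size UNIV (2 * h). K X * of_int (shell_moment (2 * h) m (count X))))"
  proof (intro arg_cong[of _ _ sum_list] map_cong refl, clarify)
    fix u m assume "(u, m) \<in> set us"
    then have "even m" using us by force
    then show "of_int u * (2 ^ (2 * h) * (\<Sum>x\<in>shell E (real m). (x \<bullet> y) ^ (2 * h))) =
      of_int u * (\<Sum>X\<in>multisets_of_size UNIV (2 * h). K X * of_int (shell_moment (2 * h) m (count X)))"
      unfolding K_def by (subst shell_power_sum[OF f E]) auto
  qed
  also have "\<dots> = (\<Sum>X\<in>multisets_of_size UNIV (2 * h). K X * of_int (\<Sum>(u, m)\<leftarrow>us. u * shell_moment (2 * h) m (count X)))"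
    by (induction us) (auto simp: algebra_simps sum_distrib_left sum.distrib)
  also have "\<dots> = (\<Sum>X\<in>multisets_of_size UNIV (2 * h). K X * (of_int C * (\<Prod>i\<in>UNIV. of_int (gauss_moment (count X i)))))"
  proof (intro sum.cong refl)
    fix X :: "8 multiset" assume "X \<in> multisets_of_size UNIV (2 * h)"
    moreover have "(\<Sum>i\<in>UNIV. count X i) = (\<Sum>i\<in>set_mset X. count X i)"
      by (rule sum.mono_neutral_right) (auto simp: not_in_iff)
    ultimately have "(\<Sum>i\<in>UNIV. count X i) = 2 * h"
      by (simp add: multisets_of_size_def size_multiset_overloaded_eq)
    then show "K X * of_int (\<Sum>(u, m)\<leftarrow>us. u * shell_moment (2 * h) m (count X))
        = K X * (of_int C * (\<Prod>i\<in>UNIV. of_int (gauss_moment (count X i))))"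
      using design_check_sound[OF chk us] by simp
  qed
  also have "\<dots> = C * fact (2 * h) * (\<Sum>X\<in>multisets_of_size UNIV (2 * h). (\<Prod>i\<in>UNIV. (f i \<bullet> y) ^ count X i / fact (count X i))
      * (\<Prod>i\<in>UNIV. of_int (gauss_moment (count X i))))"
    by (simp add: K_def sum_distrib_left mult_ac)
  also have "\<dots> = C * fact (2 * h) * ((\<Sum>i\<in>UNIV. (f i \<bullet> y)\<^sup>2) ^ h / (2 ^ h * fact h))"
    by (simp only: sum_gauss_moments)
  also have "(\<Sum>i\<in>UNIV. (f i \<bullet> y)\<^sup>2) = y \<bullet> y"
    using D8_frame_inner_sum(2)[OF f, of "\<lambda>i. y \<bullet> f i" "\<lambda>i. y \<bullet> f i"]
    by (simp add: D8_frame_expand[OF f] power2_eq_square inner_commute)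
  finally show ?thesis
    by (simp add: field_simps)
qed

text \<open>The integers span the kernel of the linear system that expresses, over all exponents of
  total degree \<open>t\<close>, the proportionality of the weighted shell moments to the Gaussian ones.\<close>

lemma design_check_10: "design_check 10 [(48, 2), (1, 4)] 12288"
  unfolding design_check_def gf_state_Nil by code_simp

lemma design_check_12: "design_check 12 [(25296, 2), (20, 6), (3, 8)] 21626880"
  unfolding design_check_def gf_state_Nil by code_simp

lemma design_check_14: "design_check 14 [(22208, 2), (192, 4), (16, 6), (1, 8)] 15728640"
  unfolding design_check_def gf_state_Nil by code_simp

section \<open>Cubature formulas from power identities\<close>

lemma integrable_rotation_invariant:
  fixes g :: "real ^ 'n \<Rightarrow> real"
  assumes \<sigma>: "rotation_invariant_prob \<sigma>" and g: "continuous_on UNIV g"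
  shows "integrable \<sigma> g"
proof -
  interpret prob_space \<sigma> using \<sigma> by (simp add: rotation_invariant_prob_def)
  have sp: "space \<sigma> = sphere 0 1" and sets: "sets \<sigma> = sets (restrict_space borel (sphere 0 1))"
    using \<sigma> by (simp_all add: rotation_invariant_prob_def)
  have "g \<in> borel_measurable borel" using g by (rule borel_measurable_continuous_onI)
  then have "g \<in> borel_measurable (restrict_space borel (sphere 0 1))" by (rule measurable_restrict_space1)
  then have meas: "g \<in> borel_measurable \<sigma>" using measurable_cong_sets[OF sets refl] by blast
  have "compact (g ` sphere 0 1)"
    using g by (intro compact_continuous_image) (auto intro: continuous_on_subset)
  then obtain B where "\<And>x. x \<in> sphere 0 1 \<Longrightarrow> norm (g x) \<le> B"
    by (metis bounded_iff compact_imp_bounded imageI)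
  then show ?thesis using meas sp by (intro integrable_const_bound[where B = B]) auto
qed

lemma integral_rotation_invariant:
  fixes g :: "real ^ 'n \<Rightarrow> real"
  assumes \<sigma>: "rotation_invariant_prob \<sigma>" and g: "continuous_on UNIV g" and A: "rotation_matrix A"
  shows "(\<integral>x. g (A *v x) \<partial>\<sigma>) = (\<integral>x. g x \<partial>\<sigma>)"
proof -
  have sets: "sets \<sigma> = sets (restrict_space borel (sphere 0 1))"
    and inv: "distr \<sigma> \<sigma> (\<lambda>x. A *v x) = \<sigma>"
    using \<sigma> A by (simp_all add: rotation_invariant_prob_def)
  have T: "orthogonal_transformation (\<lambda>x. A *v x)"
    using A by (simp add: rotation_matrix_def orthogonal_transformation_matrix)
  have "continuous_on UNIV (\<lambda>x. A *v x)"
    by (intro linear_continuous_on linear_conv_bounded_linear[THEN iffD1]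
        orthogonal_transformation_linear T)
  then have "(\<lambda>x. A *v x) \<in> borel_measurable borel" by (rule borel_measurable_continuous_onI)
  then have "(\<lambda>x. A *v x) \<in> measurable (restrict_space borel (sphere 0 1)) (restrict_space borel (sphere 0 1))"
    by (intro measurable_restrict_space3) (auto simp: orthogonal_transformation_norm[OF T])
  then have meas: "(\<lambda>x. A *v x) \<in> measurable \<sigma> \<sigma>" using measurable_cong_sets[OF sets sets] by blast
  have "g \<in> borel_measurable \<sigma>" using integrable_rotation_invariant[OF \<sigma> g] by simp
  then have "(\<integral>x. g x \<partial>distr \<sigma> \<sigma> (\<lambda>x. A *v x)) = (\<integral>x. g (A *v x) \<partial>\<sigma>)"
    using meas by (intro integral_distr)
  then show ?thesis by (simp add: inv)
qed

text \<open>Rotations are transitive on unit vectors from dimension 2 on, so the integral depends on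
  y only through |y|, and homogeneity fixes how.\<close>

lemma integral_inner_power:
  fixes \<sigma> :: "(real ^ 'n) measure"
  assumes \<sigma>: "rotation_invariant_prob \<sigma>" and n: "2 \<le> CARD('n)"
  obtains c where "\<And>y. (\<integral>x. (x \<bullet> y) ^ (2 * h) \<partial>\<sigma>) = c * (y \<bullet> y) ^ h"
proof -
  define e where "e = (axis undefined 1 :: real ^ 'n)"
  have e: "norm e = 1" by (simp add: e_def)
  have "(\<integral>x. (x \<bullet> y) ^ (2 * h) \<partial>\<sigma>) = (\<integral>x. (x \<bullet> e) ^ (2 * h) \<partial>\<sigma>) * (y \<bullet> y) ^ h" for y
  proof -
    have "norm (norm y *\<^sub>R e) = norm y" by (simp add: e)
    then obtain T where T: "orthogonal_transformation T" "det (matrix T) = 1" "T (norm y *\<^sub>R e) = y"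
      using rotation_exists[OF n] by metis
    have mat: "matrix T *v x = T x" for x
      using orthogonal_transformation_linear[OF T(1)] by (simp add: matrix_works linear_matrix_vector_mul_eq)
    have rot: "rotation_matrix (matrix T)"
      using T(1,2) by (simp add: rotation_matrix_def orthogonal_transformation_matrix)
    have "(\<integral>x. (x \<bullet> y) ^ (2 * h) \<partial>\<sigma>) = (\<integral>x. ((matrix T *v x) \<bullet> y) ^ (2 * h) \<partial>\<sigma>)"
      by (rule integral_rotation_invariant[OF \<sigma> _ rot, symmetric]) (intro continuous_intros)
    also have "\<dots> = (\<integral>x. norm y ^ (2 * h) * (x \<bullet> e) ^ (2 * h) \<partial>\<sigma>)"
    proof (intro Bochner_Integration.integral_cong refl)
      fix x
      have "(matrix T *v x) \<bullet> y = T x \<bullet> T (norm y *\<^sub>R e)" by (simp only: mat T(3))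
      also have "\<dots> = norm y * (x \<bullet> e)" using T(1) by (simp add: orthogonal_transformation_def)
      finally show "((matrix T *v x) \<bullet> y) ^ (2 * h) = norm y ^ (2 * h) * (x \<bullet> e) ^ (2 * h)"
        by (simp add: power_mult_distrib)
    qed
    finally show ?thesis by (simp add: power_mult power2_norm_eq_inner)
  qed
  then show thesis by (rule that)
qed

lemma minus_mat_1_vector_mult: "(- mat 1 :: real ^ 'n ^ 'n) *v x = - x"
proof -
  have "(- A) *v x = - (A *v x)" for A :: "real ^ 'n ^ 'n"
    by (simp add: matrix_vector_mult_def vec_eq_iff sum_negf)
  then show ?thesis by simp
qed

text \<open>In even dimension the antipodal map has determinant 1. Rotation invariance then makes
  integrals of odd functions vanish.\<close>

lemma rotation_matrix_minus_one:
  assumes "even CARD('n)"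
  shows "rotation_matrix (- mat 1 :: real ^ 'n ^ 'n)"
proof -
  have "det (- mat 1 :: real ^ 'n ^ 'n) = (\<Prod>i\<in>(UNIV :: 'n set). - 1)"
    by (subst det_diagonal) (auto simp: mat_def)
  then have "det (- mat 1 :: real ^ 'n ^ 'n) = 1" using assms by simp
  moreover have "orthogonal_transformation (\<lambda>x :: real ^ 'n. (- mat 1 :: real ^ 'n ^ 'n) *v x)"
    unfolding minus_mat_1_vector_mult by (auto simp: orthogonal_transformation_def intro: linearI)
  then have "orthogonal_matrix (- mat 1 :: real ^ 'n ^ 'n)"
    unfolding orthogonal_transformation_matrix matrix_of_matrix_vector_mul by blast
  ultimately show ?thesis by (simp add: rotation_matrix_def)
qed

section \<open>Products of linear forms and polarization\<close>

definition prod_inner :: "'a::real_inner list \<Rightarrow> 'a \<Rightarrow> real" where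
  "prod_inner vs x = prod_list (map (\<lambda>v. x \<bullet> v) vs)"

lemma prod_inner_simps [simp]:
  "prod_inner [] x = 1" "prod_inner (v # vs) x = (x \<bullet> v) * prod_inner vs x"
  by (simp_all add: prod_inner_def)

lemma continuous_prod_inner: "continuous_on UNIV (prod_inner vs)"
  by (induction vs) (auto simp: fun_eq_iff intro!: continuous_intros)

lemma prod_inner_minus: "prod_inner vs (- x) = (- 1) ^ length vs * prod_inner vs x"
  by (induction vs) auto

text \<open>Polarization: the mixed products are coefficients of powers of \<open>x \<bullet> (u + s v)\<close> as polynomials in \<open>s\<close>.\<close>

lemma polarization:
  fixes \<Phi> :: "('a::real_inner \<Rightarrow> real) \<Rightarrow> real"
  assumes lin: "\<And>(c :: nat \<Rightarrow> real) g n. (\<And>j. continuous_on UNIV (g j)) \<Longrightarrow>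
      \<Phi> (\<lambda>x. \<Sum>j\<le>n. c j * g j x) = (\<Sum>j\<le>n. c j * \<Phi> (g j))"
    and pow: "\<And>u. \<Phi> (\<lambda>x. (x \<bullet> u) ^ d) = 0" and "k + length vs = d"
  shows "\<Phi> (\<lambda>x. (x \<bullet> u) ^ k * prod_inner vs x) = 0"
  using assms(3)
proof (induction vs arbitrary: u k)
  case Nil
  then show ?case using pow by simp
next
  case (Cons v vs)
  define g where "g = (\<lambda>j x. (x \<bullet> u) ^ (Suc k - j) * (x \<bullet> v) ^ j * prod_inner vs x)"
  define a where "a = (\<lambda>j. real (Suc k choose j) * \<Phi> (g j))"
  have cont: "continuous_on UNIV (g j)" for j
    unfolding g_def by (intro continuous_intros continuous_prod_inner)
  have "(\<Sum>j\<le>Suc k. a j * s ^ j) = 0" for s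
  proof -
    have "(x \<bullet> (u + s *\<^sub>R v)) ^ Suc k * prod_inner vs x
        = (\<Sum>j\<le>Suc k. (real (Suc k choose j) * s ^ j) * g j x)" for x
    proof -
      have "(x \<bullet> (u + s *\<^sub>R v)) ^ Suc k = (s * (x \<bullet> v) + x \<bullet> u) ^ Suc k"
        by (simp add: inner_add_right add.commute)
      also have "\<dots> = (\<Sum>j\<le>Suc k. real (Suc k choose j) * (s * (x \<bullet> v)) ^ j * (x \<bullet> u) ^ (Suc k - j))"
        by (rule binomial_ring)
      finally show ?thesis
        by (simp only: sum_distrib_right sum_distrib_left g_def power_mult_distrib mult_ac)
    qed
    then have "\<Phi> (\<lambda>x. (x \<bullet> (u + s *\<^sub>R v)) ^ Suc k * prod_inner vs x)
        = (\<Sum>j\<le>Suc k. (real (Suc k choose j) * s ^ j) * \<Phi> (g j))"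
      using lin[of g "\<lambda>j. real (Suc k choose j) * s ^ j" "Suc k", OF cont] by simp
    moreover have "\<Phi> (\<lambda>x. (x \<bullet> (u + s *\<^sub>R v)) ^ Suc k * prod_inner vs x) = 0"
      using Cons.prems by (intro Cons.IH) simp
    ultimately show ?thesis by (simp only: a_def mult_ac)
  qed
  \<comment> \<open>The polynomial in s vanishes identically, and its linear coefficient is the form
    with one factor u replaced by v, up to k + 1.\<close>
  then have "a 1 = 0" using polyfun_eq_0[of a "Suc k"] by auto
  then have "\<Phi> (g 1) = 0" by (simp add: a_def)
  moreover have "g 1 = (\<lambda>x. (x \<bullet> u) ^ k * prod_inner (v # vs) x)" by (simp add: g_def fun_eq_iff)
  ultimately show ?case by simp
qed

lemma monomial_eq_prod_inner:
  fixes a :: "'n::finite \<Rightarrow> nat"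
  assumes "finite I"
  shows "\<exists>vs :: (real ^ 'n) list. length vs = (\<Sum>i\<in>I. a i) \<and> (\<forall>x. (\<Prod>i\<in>I. (x $ i) ^ a i) = prod_inner vs x)"
  using assms
proof (induction I)
  case (insert i I)
  then obtain vs :: "(real ^ 'n) list" where vs: "length vs = (\<Sum>i\<in>I. a i)" "\<And>x. (\<Prod>i\<in>I. (x $ i) ^ a i) = prod_inner vs x"
    by blast
  have "prod_inner (replicate k (axis i 1) @ vs) x = (x $ i) ^ k * prod_inner vs x" for k x
    by (induction k) (simp_all add: inner_axis)
  then show ?case using insert.hyps vs by (intro exI[of _ "replicate (a i) (axis i 1) @ vs"]) simp
qed simp

theorem cubature_formula_of_power_identity:
  fixes \<sigma> :: "(real ^ 'n) measure"
  assumes \<sigma>: "rotation_invariant_prob \<sigma>" and n: "even CARD('n)"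
    and X: "finite X" "X \<subseteq> sphere 0 1" "X \<noteq> {}" and W: "\<And>x. x \<in> X \<Longrightarrow> W x > 0"
    and anti: "\<And>x. x \<in> X \<Longrightarrow> - x \<in> X \<and> W (- x) = W x"
    and pow: "\<And>y. (\<Sum>x\<in>X. W x * (x \<bullet> y) ^ (2 * h)) = c * (y \<bullet> y) ^ h"
  shows "\<exists>W. cubature_formula \<sigma> (2 * h + 1) X W"
proof -
  interpret prob_space \<sigma> using \<sigma> by (simp add: rotation_invariant_prob_def)
  have sp: "space \<sigma> = sphere 0 1" using \<sigma> by (simp add: rotation_invariant_prob_def)
  have xx: "x \<bullet> x = 1" if "x \<in> sphere 0 1" for x :: "real ^ 'n" using that by (simp add: norm_eq_1)
  have "2 \<le> CARD('n)" using n zero_less_card_finite[where 'a = 'n] by presburger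
  then obtain cI where cI: "\<And>y. (\<integral>x. (x \<bullet> y) ^ (2 * h) \<partial>\<sigma>) = cI * (y \<bullet> y) ^ h"
    using integral_inner_power[OF \<sigma>] by blast
  note integrable = integrable_rotation_invariant[OF \<sigma>]
  define S where "S = (\<Sum>x\<in>X. W x)"
  have S: "S > 0" unfolding S_def using X W by (intro sum_pos) auto
  \<comment> \<open>Cross-multiplying makes the two power identities cancel without dividing by
    constants whose sign is not yet known.\<close>
  define \<Phi> where "\<Phi> = (\<lambda>g. cI * (\<Sum>x\<in>X. W x * g x) - c * (\<integral>x. g x \<partial>\<sigma>))"
  have \<Phi>_lin: "\<Phi> (\<lambda>x. \<Sum>j\<in>J. a j * g j x) = (\<Sum>j\<in>J. a j * \<Phi> (g j))"
    if "\<And>j. continuous_on UNIV (g j)" for J :: "'b set" and a g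
  proof -
    define A where "A = (\<lambda>j. \<Sum>x\<in>X. W x * g j x)"
    define B where "B = (\<lambda>j. \<integral>x. g j x \<partial>\<sigma>)"
    have "(\<Sum>x\<in>X. W x * (\<Sum>j\<in>J. a j * g j x)) = (\<Sum>j\<in>J. a j * A j)"
      unfolding A_def sum_distrib_left by (subst sum.swap) (simp add: mult_ac)
    moreover have "(\<integral>x. (\<Sum>j\<in>J. a j * g j x) \<partial>\<sigma>) = (\<Sum>j\<in>J. a j * B j)"
      using integrable[OF that] by (simp add: B_def)
    moreover have "\<Phi> (\<lambda>x. \<Sum>j\<in>J. a j * g j x) = cI * (\<Sum>x\<in>X. W x * (\<Sum>j\<in>J. a j * g j x))
        - c * (\<integral>x. (\<Sum>j\<in>J. a j * g j x) \<partial>\<sigma>)" by (simp only: \<Phi>_def)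
    moreover have "\<Phi> (g j) = cI * A j - c * B j" for j by (simp add: \<Phi>_def A_def B_def)
    ultimately show ?thesis
      by (simp add: sum_distrib_left sum_subtractf right_diff_distrib mult_ac)
  qed
  have \<Phi>_cong: "\<Phi> g = \<Phi> g'" if "\<And>x. x \<in> sphere 0 1 \<Longrightarrow> g x = g' x" for g g'
  proof -
    have "(\<Sum>x\<in>X. W x * g x) = (\<Sum>x\<in>X. W x * g' x)" using that X(2) by (intro sum.cong) auto
    moreover have "(\<integral>x. g x \<partial>\<sigma>) = (\<integral>x. g' x \<partial>\<sigma>)"
      using that sp by (intro Bochner_Integration.integral_cong) auto
    ultimately show ?thesis by (simp add: \<Phi>_def)
  qed
  have top: "\<Phi> (prod_inner vs) = 0" if "length vs = 2 * h" for vs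
  proof -
    have "\<Phi> (\<lambda>x. (x \<bullet> u) ^ (2 * h)) = 0" for u by (simp add: \<Phi>_def pow cI)
    from polarization[of \<Phi> "2 * h" 0 vs 0, OF \<Phi>_lin this] show ?thesis using that by simp
  qed
  have even: "\<Phi> (prod_inner vs) = 0" if "length vs + 2 * l = 2 * h" for vs l
    using that
  proof (induction l arbitrary: vs)
    case 0
    then show ?case using top by simp
  next
    case (Suc l)
    have "\<Phi> (prod_inner vs) = \<Phi> (\<lambda>x. \<Sum>b\<in>Basis. 1 * prod_inner (b # b # vs) x)"
    proof (rule \<Phi>_cong)
      fix x :: "real ^ 'n" assume "x \<in> sphere 0 1"
      have "(\<Sum>b\<in>Basis. 1 * prod_inner (b # b # vs) x) = (\<Sum>b\<in>Basis. (x \<bullet> b) * (x \<bullet> b)) * prod_inner vs x"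
        by (simp add: sum_distrib_right sum_distrib_left mult_ac)
      also have "(\<Sum>b\<in>Basis. (x \<bullet> b) * (x \<bullet> b)) = x \<bullet> x" by (rule euclidean_inner[symmetric])
      finally show "prod_inner vs x = (\<Sum>b\<in>Basis. 1 * prod_inner (b # b # vs) x)"
        using xx[OF \<open>x \<in> sphere 0 1\<close>] by simp
    qed
    also have "\<dots> = (\<Sum>b\<in>Basis. 1 * \<Phi> (prod_inner (b # b # vs)))"
      by (rule \<Phi>_lin) (rule continuous_prod_inner)
    also have "\<dots> = 0" using Suc.prems by (intro sum.neutral ballI) (simp add: Suc.IH)
    finally show ?case .
  qed
  have "prod_inner [] = (\<lambda>x :: real ^ 'n. 1)" by (simp add: fun_eq_iff)
  then have "\<Phi> (prod_inner []) = cI * S - c" by (simp add: \<Phi>_def S_def prob_space)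
  then have c: "c = cI * S" using even[of "[]" h] by simp
  \<comment> \<open>Otherwise c = cI * S would vanish too, while the weighted power sum at y = x0
    contains the positive term of x0 itself.\<close>
  have "cI \<noteq> 0"
  proof
    assume "cI = 0"
    obtain x0 where x0: "x0 \<in> X" using X(3) by blast
    have "W x0 * (x0 \<bullet> x0) ^ (2 * h) \<le> (\<Sum>x\<in>X. W x * (x \<bullet> x0) ^ (2 * h))"
      using X(1) x0 W by (intro member_le_sum) (auto simp: less_imp_le)
    then show False using pow[of x0] c \<open>cI = 0\<close> W[OF x0] xx[of x0] x0 X(2) by auto
  qed
  define V where "V = (\<lambda>x. W x / S)"
  have quad: "(\<Sum>x\<in>X. V x * prod_inner vs x) = (\<integral>x. prod_inner vs x \<partial>\<sigma>)" if len: "length vs \<le> 2 * h + 1" for vs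
  proof (cases "even (length vs)")
    case True
    then obtain l where "length vs = 2 * l" by (rule evenE)
    then have "length vs + 2 * (h - l) = 2 * h" using len by simp
    then have "\<Phi> (prod_inner vs) = 0" by (rule even)
    then have "cI * ((\<Sum>x\<in>X. W x * prod_inner vs x) - S * (\<integral>x. prod_inner vs x \<partial>\<sigma>)) = 0"
      by (simp add: \<Phi>_def c algebra_simps)
    then show ?thesis using \<open>cI \<noteq> 0\<close> S by (simp add: V_def field_simps flip: sum_divide_distrib)
  next
    case False
    have odd: "prod_inner vs (- x) = - prod_inner vs x" for x using False by (simp add: prod_inner_minus)
    have "bij_betw uminus X X" using anti by (intro bij_betwI[of _ _ _ uminus]) auto
    then have "(\<Sum>x\<in>X. V x * prod_inner vs x) = (\<Sum>x\<in>X. V (- x) * prod_inner vs (- x))"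
      by (rule sum.reindex_bij_betw[symmetric])
    also have "\<dots> = - (\<Sum>x\<in>X. V x * prod_inner vs x)"
      using anti by (simp add: odd V_def sum_negf)
    finally have "(\<Sum>x\<in>X. V x * prod_inner vs x) = 0" by simp
    moreover have "(\<integral>x. prod_inner vs x \<partial>\<sigma>) = (\<integral>x. prod_inner vs (- mat 1 *v x) \<partial>\<sigma>)"
      by (rule integral_rotation_invariant[OF \<sigma> continuous_prod_inner rotation_matrix_minus_one[OF n], symmetric])
    then have "(\<integral>x. prod_inner vs x \<partial>\<sigma>) = 0" by (simp add: minus_mat_1_vector_mult odd)
    ultimately show ?thesis by simp
  qed
  have "cubature_formula \<sigma> (2 * h + 1) X V"
    unfolding cubature_formula_def
  proof (intro conjI allI impI ballI)
    fix f :: "real ^ 'n \<Rightarrow> complex"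
    assume "poly_fun_deg_le (2 * h + 1) f"
    then obtain a where f: "f = (\<lambda>x. \<Sum>\<alpha> | (\<Sum>i\<in>UNIV. \<alpha> i) \<le> 2 * h + 1. a \<alpha> * (\<Prod>i\<in>UNIV. complex_of_real (x $ i) ^ \<alpha> i))"
      by (auto simp: poly_fun_deg_le_def)
    define D where "D = {\<alpha> :: 'n \<Rightarrow> nat. (\<Sum>i\<in>UNIV. \<alpha> i) \<le> 2 * h + 1}"
    define mon where "mon = (\<lambda>(\<alpha> :: 'n \<Rightarrow> nat) (x :: real ^ 'n). \<Prod>i\<in>UNIV. (x $ i) ^ \<alpha> i)"
    have f': "f x = (\<Sum>\<alpha>\<in>D. a \<alpha> * complex_of_real (mon \<alpha> x))" for x
      by (simp add: f D_def mon_def)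
    have mon: "(\<Sum>x\<in>X. V x * mon \<alpha> x) = (\<integral>x. mon \<alpha> x \<partial>\<sigma>)" if "\<alpha> \<in> D" for \<alpha>
    proof -
      obtain vs :: "(real ^ 'n) list" where "length vs = (\<Sum>i\<in>UNIV. \<alpha> i)" "\<forall>x. mon \<alpha> x = prod_inner vs x"
        using monomial_eq_prod_inner[of UNIV \<alpha>] by (auto simp: mon_def)
      then show ?thesis using quad[of vs] that by (simp add: D_def)
    qed
    have int: "integrable \<sigma> (\<lambda>x. complex_of_real (mon \<alpha> x))" for \<alpha>
      unfolding mon_def by (intro integrable_of_real integrable continuous_intros)
    have "(\<Sum>x\<in>X. complex_of_real (V x) * f x) = (\<Sum>\<alpha>\<in>D. a \<alpha> * complex_of_real (\<Sum>x\<in>X. V x * mon \<alpha> x))"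
      unfolding f' of_real_sum sum_distrib_left by (subst sum.swap) (simp add: mult_ac)
    also have "\<dots> = (\<Sum>\<alpha>\<in>D. a \<alpha> * (\<integral>x. complex_of_real (mon \<alpha> x) \<partial>\<sigma>))" by (simp add: mon)
    also have "\<dots> = (\<integral>x. f x \<partial>\<sigma>)" unfolding f' using int by simp
    finally show "(\<Sum>x\<in>X. complex_of_real (V x) * f x) = (\<integral>x. f x \<partial>\<sigma>)" .
  qed (use X W S in \<open>auto simp: V_def\<close>)
  then show ?thesis by blast
qed

lemma normalized_shell_sphere:
  assumes "m > 0"
  shows "(*\<^sub>R) (1 / sqrt m) ` shell E m \<subseteq> sphere 0 1"
  using assms by (auto simp: shell_def norm_eq_sqrt_inner)

lemma card_normalized_shell:
  assumes "m > 0"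
  shows "card ((*\<^sub>R) (1 / sqrt m) ` shell E m) = card (shell E m)"
  using assms by (intro card_image) (auto simp: inj_on_def)

lemma normalized_shell_uminus:
  assumes "add_subgroup E" "x \<in> (*\<^sub>R) a ` shell E m"
  shows "- x \<in> (*\<^sub>R) a ` shell E m"
proof -
  obtain z where z: "z \<in> shell E m" "x = a *\<^sub>R z" using assms(2) by auto
  then have "- z \<in> shell E m" using add_subgroup_uminus[OF assms(1)] by (simp add: shell_def)
  then show ?thesis using z(2) by (auto intro!: image_eqI[of _ _ "- z"])
qed

lemma not_square_between:
  fixes a k N :: int
  assumes "0 \<le> a" "a * a < N" "N < (a + 1) * (a + 1)"
  shows "k * k \<noteq> N"
proof (cases "\<bar>k\<bar> \<le> a")
  case True
  then have "\<bar>k\<bar> * \<bar>k\<bar> \<le> a * a" by (intro mult_mono) auto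
  then show ?thesis using assms(2) by simp
next
  case False
  then have "(a + 1) * (a + 1) \<le> \<bar>k\<bar> * \<bar>k\<bar>" using assms(1) by (intro mult_mono) auto
  then show ?thesis using assms(3) by simp
qed

text \<open>If \<open>x / \<surd>m = y / \<surd>n\<close> then the integer \<open>x \<bullet> y\<close> has square \<open>m n\<close>.\<close>

lemma normalized_shells_disjoint:
  assumes E: "\<And>x y. x \<in> E \<Longrightarrow> y \<in> E \<Longrightarrow> x \<bullet> y \<in> \<int>" and mn: "m > 0" "n > 0"
    and sq: "real m * real n = of_int N" "0 \<le> a" "a * a < N" "N < (a + 1) * (a + 1)"
  shows "(*\<^sub>R) (1 / sqrt (real m)) ` shell E (real m) \<inter> (*\<^sub>R) (1 / sqrt (real n)) ` shell E (real n) = {}"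
proof (rule ccontr)
  assume "\<not> ?thesis"
  then obtain x y where x: "x \<in> shell E (real m)" and y: "y \<in> shell E (real n)"
    and eq: "(1 / sqrt (real m)) *\<^sub>R x = (1 / sqrt (real n)) *\<^sub>R y" by auto
  obtain k :: int where k: "x \<bullet> y = of_int k" using E[of x y] x y by (auto simp: shell_def elim: Ints_cases)
  have "((1 / sqrt (real m)) *\<^sub>R x) \<bullet> y = ((1 / sqrt (real n)) *\<^sub>R y) \<bullet> y" by (simp only: eq)
  then have "x \<bullet> y / sqrt (real m) = real n / sqrt (real n)" using y by (simp add: shell_def)
  then have "x \<bullet> y = sqrt (real m) * sqrt (real n)" using mn by (simp add: field_simps real_div_sqrt)
  then have "(x \<bullet> y) * (x \<bullet> y) = real m * real n" by (simp add: mult_ac)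
  then have "of_int (k * k) = (of_int N :: real)" by (simp add: k sq(1))
  then show False using not_square_between[OF sq(2-4), of k] by (simp only: of_int_eq_iff)
qed

text \<open>Normalized shells can overlap, as those of norms 2 and 8 do, so the weight of a point
  adds the contributions of all shells through it. The factor m^h cancels the scaling by 1 / sqrt m
  in degree 2h.\<close>

lemma shells_cubature:
  fixes f :: "8 \<Rightarrow> real ^ 8"
  assumes grp: "add_subgroup E" and f: "D8_frame E f" and E: "E = D8_lattice f \<union> D8_glue f"
    and \<sigma>: "rotation_invariant_prob \<sigma>"
    and chk: "design_check (2 * h) us C" and us: "snd ` set us \<subseteq> {2, 4, 6, 8}" "us \<noteq> []"
    and pos: "\<forall>(u, m)\<in>set us. u > 0"
  shows "\<exists>W. cubature_formula \<sigma> (2 * h + 1) (\<Union>m\<in>snd ` set us. (*\<^sub>R) (1 / sqrt (real m)) ` shell E (real m)) W"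
proof -
  define Y where "Y = (\<lambda>m. (*\<^sub>R) (1 / sqrt (real m)) ` shell E (real m))"
  define X where "X = (\<Union>m\<in>snd ` set us. Y m)"
  define W where "W = (\<lambda>x. \<Sum>(u, m)\<leftarrow>us. of_int u * real m ^ h * of_bool (x \<in> Y m))"
  have us': "even m" "m > 0" "m \<in> {2, 4, 6, 8}" if "(u, m) \<in> set us" for u m
    using us(1) that by force+
  have finY: "finite (Y m)" if "(u, m) \<in> set us" for u m
    using sum_shell(1)[OF f E us'(1)[OF that]] by (simp add: Y_def)
  have finX: "finite X" using finY by (auto simp: X_def)
  have sphere: "X \<subseteq> sphere 0 1"
  proof
    fix x assume "x \<in> X"
    then obtain u m where um: "(u, m) \<in> set us" "x \<in> Y m" by (auto simp: X_def)
    have "Y m \<subseteq> sphere 0 1"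
      unfolding Y_def using us'(2)[OF um(1)] by (intro normalized_shell_sphere) simp
    then show "x \<in> sphere 0 1" using um(2) by blast
  qed
  obtain u0 m0 where um0: "(u0, m0) \<in> set us" using us(2) by (cases us) auto
  have "card (Y m0) = card (shell E (real m0))"
    unfolding Y_def using us'(2)[OF um0] by (intro card_normalized_shell) simp
  then have "card (Y m0) > 0" using card_shell_values[OF f E] us'(3)[OF um0] by auto
  then have "X \<noteq> {}" using um0 by (force simp: X_def)
  have Wpos: "W x > 0" if x: "x \<in> X" for x
  proof -
    have nonneg: "(\<Sum>(u, m)\<leftarrow>vs. of_int u * real m ^ h * of_bool (x \<in> Y m)) \<ge> 0" if "set vs \<subseteq> set us" for vs
      using that by (induction vs) (use pos in force)+
    have "(\<Sum>(u, m)\<leftarrow>vs. of_int u * real m ^ h * of_bool (x \<in> Y m)) > 0"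
      if "set vs \<subseteq> set us" "\<exists>(u, m)\<in>set vs. x \<in> Y m" for vs
      using that
    proof (induction vs)
      case (Cons v vs)
      obtain u m where v: "v = (u, m)" by (cases v)
      then have um: "u > 0" "m > 0" using Cons.prems(1) pos us'(2) by auto
      then have "of_int u * real m ^ h > 0" by simp
      then show ?case
        using Cons nonneg[of vs] by (cases "x \<in> Y m") (auto simp: v intro: add_pos_nonneg)
    qed simp
    from this[of us] show ?thesis using x by (force simp: W_def X_def)
  qed
  have sum_W: "(\<Sum>x\<in>X. W x * g x) = (\<Sum>(u, m)\<leftarrow>us. of_int u * real m ^ h * (\<Sum>x\<in>Y m. g x))" for g :: "real ^ 8 \<Rightarrow> real"
  proof -
    have "(\<Sum>x\<in>X. (\<Sum>(u, m)\<leftarrow>vs. of_int u * real m ^ h * of_bool (x \<in> Y m)) * g x)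
        = (\<Sum>(u, m)\<leftarrow>vs. of_int u * real m ^ h * (\<Sum>x\<in>Y m. g x))" if "set vs \<subseteq> set us" for vs
      using that
    proof (induction vs)
      case (Cons v vs)
      obtain u m where v: "v = (u, m)" by (cases v)
      then have "Y m \<subseteq> X" using Cons.prems by (force simp: X_def)
      then have "(\<Sum>x\<in>X. of_bool (x \<in> Y m) * g x) = (\<Sum>x\<in>Y m. g x)"
        using finX by (intro sum.mono_neutral_cong_right) auto
      then have "(\<Sum>x\<in>X. of_int u * real m ^ h * of_bool (x \<in> Y m) * g x) = of_int u * real m ^ h * (\<Sum>x\<in>Y m. g x)"
        by (simp only: sum_distrib_left[symmetric] mult.assoc)
      then show ?case using Cons by (simp add: v distrib_right sum.distrib)
    qed simp
    then show ?thesis unfolding W_def by blast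
  qed
  have sum_Y: "real m ^ h * (\<Sum>x\<in>Y m. (x \<bullet> y) ^ (2 * h)) = (\<Sum>x\<in>shell E (real m). (x \<bullet> y) ^ (2 * h))"
    if "m > 0" for m y
  proof -
    have inj: "inj_on ((*\<^sub>R) (1 / sqrt (real m))) (shell E (real m))" using that by (auto simp: inj_on_def)
    have "real m ^ h * (x \<bullet> y / sqrt (real m)) ^ (2 * h) = (x \<bullet> y) ^ (2 * h)" for x
      using that by (simp add: power_divide power_mult)
    then show ?thesis
      unfolding Y_def sum.reindex[OF inj] by (simp add: sum_distrib_left)
  qed
  have pow: "(\<Sum>x\<in>X. W x * (x \<bullet> y) ^ (2 * h))
      = (C * fact (2 * h) / (2 ^ (2 * h) * (2 ^ h * fact h))) * (y \<bullet> y) ^ h" for y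
  proof -
    have "(\<Sum>x\<in>X. W x * (x \<bullet> y) ^ (2 * h))
        = (\<Sum>(u, m)\<leftarrow>us. of_int u * (\<Sum>x\<in>shell E (real m). (x \<bullet> y) ^ (2 * h)))"
      unfolding sum_W using us'(2) by (intro arg_cong[of _ _ sum_list] map_cong) (auto simp: mult.assoc sum_Y)
    then show ?thesis using design_identity[OF f E chk us(1)] by simp
  qed
  have anti: "- x \<in> X \<and> W (- x) = W x" if "x \<in> X" for x
  proof -
    have "- x \<in> Y m \<longleftrightarrow> x \<in> Y m" for m x
      unfolding Y_def using normalized_shell_uminus[OF grp] by (metis minus_minus)
    then show ?thesis using that by (simp add: X_def W_def)
  qed
  show ?thesis
    using cubature_formula_of_power_identity[OF \<sigma> _ finX sphere \<open>X \<noteq> {}\<close> Wpos anti pow]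
    by (simp add: X_def Y_def)
qed

theorem mainTheorem2:
  fixes E :: "(real ^ 8) set" and \<sigma> :: "(real ^ 8) measure"
  assumes "even_lattice E" and "unimodular_lattice E"
    and "rotation_invariant_prob \<sigma>"
  shows
    "(let X = (*\<^sub>R) (1 / sqrt 2) ` shell E 2 \<union> (*\<^sub>R) (1 / 2) ` shell E 4
      in (\<exists>W. cubature_formula \<sigma> 11 X W) \<and> card X = 2400) \<and>
     (let X = (*\<^sub>R) (1 / sqrt 2) ` shell E 2 \<union> (*\<^sub>R) (1 / sqrt 6) ` shell E 6
            \<union> (*\<^sub>R) (1 / (2 * sqrt 2)) ` shell E 8
      in (\<exists>W. cubature_formula \<sigma> 13 X W) \<and> card X = 24240) \<and>
     (let X = (*\<^sub>R) (1 / sqrt 2) ` shell E 2 \<union> (*\<^sub>R) (1 / 2) ` shell E 4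
            \<union> (*\<^sub>R) (1 / sqrt 6) ` shell E 6 \<union> (*\<^sub>R) (1 / (2 * sqrt 2)) ` shell E 8
      in (\<exists>W. cubature_formula \<sigma> 15 X W) \<and> card X = 26400)"
proof -
  have sdE: "self_dual_in UNIV E"
    using assms(2) by (auto simp: self_dual_in_def unimodular_lattice_def dual_lattice_def)
  note sd = self_dual_inD[OF sdE]
  note grp = self_dual_in_subgroup[OF sdE]
  have even: "\<And>x. x \<in> E \<Longrightarrow> \<exists>k::int. x \<bullet> x = 2 * of_int k"
    using assms(1) by (simp add: even_lattice_def)
  obtain f where f: "D8_frame E f" and E: "E = D8_lattice f \<union> D8_glue f"
    using even_unimodular_E8_coordinates[OF sdE even] by auto
  define Y where "Y = (\<lambda>m. (*\<^sub>R) (1 / sqrt (real m)) ` shell E (real m))"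
  have "sqrt (2 ^ 2 * 2) = 2 * sqrt 2" by (subst real_sqrt_mult) simp
  then have "sqrt 8 = 2 * sqrt 2" by simp
  then have Y: "(*\<^sub>R) (1 / sqrt 2) ` shell E 2 = Y 2" "(*\<^sub>R) (1 / 2) ` shell E 4 = Y 4"
    "(*\<^sub>R) (1 / sqrt 6) ` shell E 6 = Y 6" "(*\<^sub>R) (1 / (2 * sqrt 2)) ` shell E 8 = Y 8"
    by (simp_all add: Y_def)
  have card: "card (Y 2) = 240" "card (Y 4) = 2160" "card (Y 6) = 6720" "card (Y 8) = 17520"
    using card_normalized_shell[of "real 2" E] card_normalized_shell[of "real 4" E]
      card_normalized_shell[of "real 6" E] card_normalized_shell[of "real 8" E]
    unfolding Y_def of_nat_numeral card_shell_values[OF f E] by simp_all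
  have fin: "finite (Y 2)" "finite (Y 4)" "finite (Y 6)" "finite (Y 8)"
    using card by (auto intro: card_ge_0_finite)
  \<comment> \<open>In each case N = m n lies strictly between a^2 and (a + 1)^2. The pair 2, 8 is
    absent because 2 * 8 is a square.\<close>
  have disj: "Y 2 \<inter> Y 4 = {}" "Y 2 \<inter> Y 6 = {}" "Y 4 \<inter> Y 6 = {}" "Y 4 \<inter> Y 8 = {}" "Y 6 \<inter> Y 8 = {}"
    unfolding Y_def
    using normalized_shells_disjoint[where E = E and m = 2 and n = 4 and N = 8 and a = 2, OF sd(3)] normalized_shells_disjoint[where E = E and m = 2 and n = 6 and N = 12 and a = 3, OF sd(3)]
      normalized_shells_disjoint[where E = E and m = 4 and n = 6 and N = 24 and a = 4, OF sd(3)] normalized_shells_disjoint[where E = E and m = 4 and n = 8 and N = 32 and a = 5, OF sd(3)]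
      normalized_shells_disjoint[where E = E and m = 6 and n = 8 and N = 48 and a = 6, OF sd(3)] by simp_all
  \<comment> \<open>Doubling a root gives a vector of norm 8 in the same direction. Hence the sizes
    of the last two supports do not include a separate 240.\<close>
  have sub: "Y 2 \<subseteq> Y 8"
  proof
    fix x assume "x \<in> Y 2"
    then obtain z where z: "z \<in> shell E 2" "x = (1 / sqrt 2) *\<^sub>R z" by (auto simp: Y_def)
    then have "2 *\<^sub>R z \<in> shell E 8"
      using add_subgroup_scaleR_Ints[OF grp, of z 2] by (simp add: shell_def)
    moreover have "x = (1 / (2 * sqrt 2)) *\<^sub>R (2 *\<^sub>R z)" using z(2) by simp
    ultimately show "x \<in> Y 8" unfolding Y(4)[symmetric] by blast
  qed
  have 11: "\<exists>W. cubature_formula \<sigma> 11 (Y 2 \<union> Y 4) W"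
    using shells_cubature[OF grp f E assms(3), of 5 "[(48, 2), (1, 4)]" 12288] design_check_10
    by (auto simp: Y_def)
  have 13: "\<exists>W. cubature_formula \<sigma> 13 (Y 2 \<union> Y 6 \<union> Y 8) W"
    using shells_cubature[OF grp f E assms(3), of 6 "[(25296, 2), (20, 6), (3, 8)]" 21626880] design_check_12
    by (auto simp: Y_def Un_assoc)
  have 15: "\<exists>W. cubature_formula \<sigma> 15 (Y 2 \<union> Y 4 \<union> Y 6 \<union> Y 8) W"
    using shells_cubature[OF grp f E assms(3), of 7 "[(22208, 2), (192, 4), (16, 6), (1, 8)]" 15728640] design_check_14
    by (auto simp: Y_def Un_assoc)
  have "card (Y 2 \<union> Y 4) = 2400"
    using disj card fin by (simp add: card_Un_disjoint)
  moreover have "Y 2 \<union> Y 6 \<union> Y 8 = Y 6 \<union> Y 8" using sub by blast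
  then have "card (Y 2 \<union> Y 6 \<union> Y 8) = 24240"
    using disj card fin by (simp add: card_Un_disjoint)
  moreover have "Y 2 \<union> Y 4 \<union> Y 6 \<union> Y 8 = Y 4 \<union> (Y 6 \<union> Y 8)" using sub by blast
  then have "card (Y 2 \<union> Y 4 \<union> Y 6 \<union> Y 8) = 26400"
    using disj card fin by (simp add: card_Un_disjoint Int_Un_distrib)
  ultimately show ?thesis unfolding Y Let_def using 11 13 15 by blast
qed

end
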